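(* Let $\xi_k,\gamma_{jk},\beta_j\in\mathbb{C}$ ($1\leqslant j\leqslant d$, $1\leqslant k\leqslant r$) with $|\xi_k|\leqslant1$, $\Re\gamma_{jk}\geqslant0$, $\Re\beta_j>0$, and for each $j$ at least one $\Re\gamma_{jk}>0$; let $\delta(k)=1$ if $\xi_k=1$ and $0$ otherwise. Let $\zeta_r^{\rm des}((s_j);(\xi_k);(\gamma_{jk});(\beta_j))$ be the entire function $$\frac{1}{\prod_{j=1}^d(e^{2\pi i s_j}-1)\Gamma(s_j)}\int_{\mathcal{C}^d}\prod_{j=1}^d x_j^{s_j-1}e^{(\sum_{k=1}^r\gamma_{jk}-\beta_j)x_j}dx_j\prod_{k=1}^rF_{\delta(k)}\Bigl(\sum_{j=1}^d\gamma_{jk}x_j,\xi_k\Bigr),$$ where $F_\delta(y,\xi)=\frac{1}{e^y-\xi}-\delta\frac{ye^y}{(e^y-1)^2}=\sum_{n=0}^\infty F_\delta^n(\xi)\frac{y^n}{n!}$ (Taylor expansion at $y=0$). Then for $\lambda_1,\dots,\lambda_d\in\mathbb{N}_0$, $$\zeta_r^{\rm des}((-\lambda_j);(\xi_k);(\gamma_{jk});(\beta_j))=\prod_{j=1}^d(-1)^{\lambda_j}\lambda_j!\sum_{\substack{m_j+\nu_{j1}+\cdots+\nu_{jr}=\lambda_j\\(1\leqslant j\leqslant d)}}\Bigl(\prod_{k=1}^rF_{\delta(k)}^{\nu_{1k}+\cdots+\nu_{dk}}(\xi_k)\Bigr)\Bigl(\prod_{j=1}^d\frac{(\sum_{k=1}^r\gamma_{jk}-\beta_j)^{m_j}}{m_j!}\Bigr)\Bigl(\prod_{j=1}^d\prod_{k=1}^r\frac{\gamma_{jk}^{\nu_{jk}}}{\nu_{jk}!}\Bigr),$$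 the sum running over nonnegative integers $m_j,\nu_{jk}$.
   Context: $\mathcal{C}$ is the Hankel contour (from $+\infty$ along the upper side of the positive real axis, counterclockwise around a small circle about $0$, back to $+\infty$ along the lower side), with $\arg x=0$ on the upper side and $2\pi$ on the lower side; the prefactor is understood by analytic continuation. The function above is the desingularization of the multiple zeta-function of generalized Hurwitz–Lerch type $\sum_{m_1,\dots,m_r\geqslant0}\prod_k\xi_k^{m_k}/\prod_j(\beta_j+\sum_k\gamma_{jk}m_k)^{s_j}$. $F_\delta^n(\xi)=B_{n+1}$ if $\xi=1,\delta=1$ ($B_n$ Bernoulli numbers, $y/(e^y-1)=\sum B_ny^n/n!$).
   Formalization: Adds that for small circles no pole of the integrand lies on C^d; this excludes exactly |ξ_k|=1 with some γ_jk nonzero and purely imaginary, where the defining integral diverges (e.g. d=1, γ=(1,i), ξ_2=1: double pole at x=2π) or depends on the circle's radius. *)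

theory Defs
  imports "HOL-Complex_Analysis.Complex_Analysis"
begin

no_notation fps_nth (infixl \<open>$\<close> 75)

text \<open>
  The Hankel contour with circle of radius \<open>\<epsilon>\<close>, parametrised by the whole real line:
  \<open>t < 0\<close> is the upper side of the positive real axis (traversed from \<open>+\<infinity>\<close> to \<open>\<epsilon>\<close>),
  \<open>0 \<le> t \<le> 2\<pi>\<close> the circle, \<open>t > 2\<pi>\<close> the lower side.  The contour is given through its
  lift to the logarithm, so that the argument is \<open>0\<close> on the upper and \<open>2\<pi>\<close> on the lower
  side, and \<open>x\<^sup>s\<close> is \<open>exp (s * hankel_log \<epsilon> t)\<close>.
\<close>

definition hankel_log :: "real \<Rightarrow> real \<Rightarrow> complex" where
  "hankel_log \<epsilon> t =
     (if t < 0 then of_real (ln (\<epsilon> - t))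
      else if t \<le> 2 * pi then of_real (ln \<epsilon>) + \<i> * of_real t
      else of_real (ln (\<epsilon> + (t - 2 * pi))) + 2 * of_real pi * \<i>)"

definition hankel :: "real \<Rightarrow> real \<Rightarrow> complex" where
  "hankel \<epsilon> t = exp (hankel_log \<epsilon> t)"

definition hankel_deriv :: "real \<Rightarrow> real \<Rightarrow> complex" where
  "hankel_deriv \<epsilon> t =
     (if t < 0 then -1 else if t \<le> 2 * pi then \<i> * hankel \<epsilon> t else 1)"

lemma hankel_eq:
  assumes "\<epsilon> > 0"
  shows "hankel \<epsilon> t =
     (if t < 0 then of_real (\<epsilon> - t)
      else if t \<le> 2 * pi then of_real \<epsilon> * exp (\<i> * of_real t)
      else of_real (\<epsilon> + (t - 2 * pi)))"
proof -
  have e: "exp (complex_of_real (ln a)) = of_real a" if "a > 0" for a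
    using that by (simp add: exp_of_real)
  have e2: "exp (complex_of_real (ln a) + 2 * of_real pi * \<i>) = of_real a" if "a > 0" for a
    using that e[of a] by (simp add: exp_add)
  show ?thesis
    using assms e[of "\<epsilon> - t"] e[of \<epsilon>] e2[of "\<epsilon> + (t - 2 * pi)"]
    by (auto simp: hankel_def hankel_log_def exp_add)
qed

lemma hankel_has_vector_derivative:
  assumes "\<epsilon> > 0" "t \<noteq> 0" "t \<noteq> 2 * pi"
  shows "(hankel \<epsilon> has_vector_derivative hankel_deriv \<epsilon> t) (at t)"
proof -
  consider "t < 0" | "0 < t" "t < 2 * pi" | "t > 2 * pi" using assms by linarith
  then show ?thesis
  proof cases
    case 1
    have "((\<lambda>t. of_real (\<epsilon> - t)) has_vector_derivative (-1::complex)) (at t)"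
      by (auto intro!: derivative_eq_intros simp: has_vector_derivative_def scaleR_conv_of_real)
    then have "(hankel \<epsilon> has_vector_derivative -1) (at t)"
      by (rule has_vector_derivative_transform_within_open[where S = "{..<0}"])
         (use 1 assms in \<open>auto simp: hankel_eq\<close>)
    with 1 show ?thesis by (simp add: hankel_deriv_def)
  next
    case 2
    have "((\<lambda>t. of_real \<epsilon> * exp (\<i> * of_real t)) has_vector_derivative
            \<i> * (of_real \<epsilon> * exp (\<i> * of_real t))) (at t)"
      by (rule has_vector_derivative_real_field) (auto intro!: derivative_eq_intros)
    then have "(hankel \<epsilon> has_vector_derivative \<i> * (of_real \<epsilon> * exp (\<i> * of_real t))) (at t)"
      by (rule has_vector_derivative_transform_within_open[where S = "{0<..<2*pi}"])
         (use 2 assms in \<open>auto simp: hankel_eq\<close>)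
    with 2 assms show ?thesis by (simp add: hankel_deriv_def hankel_eq)
  next
    case 3
    have "((\<lambda>t. of_real (\<epsilon> + (t - 2 * pi))) has_vector_derivative (1::complex)) (at t)"
      by (auto intro!: derivative_eq_intros simp: has_vector_derivative_def scaleR_conv_of_real)
    then have "(hankel \<epsilon> has_vector_derivative 1) (at t)"
      by (rule has_vector_derivative_transform_within_open[where S = "{2*pi<..}"])
         (use 3 assms pi_gt_zero in \<open>auto simp: hankel_eq simp del: pi_gt_zero\<close>)
    moreover have "\<not> t < 0" "\<not> t \<le> 2 * pi" using 3 pi_gt_zero by linarith+
    ultimately show ?thesis by (simp add: hankel_deriv_def)
  qed
qed

text \<open>
  The removable singularity at \<open>y = 0\<close> (for \<open>\<xi> = 1\<close>, \<open>\<delta> = 1\<close>) has to be filled in explicitly: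
  the argument \<open>y\<close> can vanish on the contour, even identically.
\<close>

definition des_F :: "nat \<Rightarrow> complex \<Rightarrow> complex \<Rightarrow> complex" where
  "des_F \<delta> \<xi> = remove_sings
     (\<lambda>y. 1 / (exp y - \<xi>) - of_nat \<delta> * (y * exp y / (exp y - 1)\<^sup>2))"

definition des_F_coeff :: "nat \<Rightarrow> complex \<Rightarrow> nat \<Rightarrow> complex" where
  "des_F_coeff \<delta> \<xi> n = (deriv ^^ n) (des_F \<delta> \<xi>) 0"

definition des_delta :: "complex \<Rightarrow> nat" where
  "des_delta \<xi> = (if \<xi> = 1 then 1 else 0)"

definition hankel_integral ::
  "real \<Rightarrow> complex^'r \<Rightarrow> complex^'r^'d \<Rightarrow> complex^'d \<Rightarrow> complex^'d \<Rightarrow> complex" where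
  "hankel_integral \<epsilon> \<xi> \<gamma> \<beta> s =
     (LINT t | PiM (UNIV :: 'd set) (\<lambda>_. lborel).
        (\<Prod>j\<in>UNIV. exp ((s $ j - 1) * hankel_log \<epsilon> (t j))
                 * exp (((\<Sum>k\<in>UNIV. \<gamma> $ j $ k) - \<beta> $ j) * hankel \<epsilon> (t j))
                 * hankel_deriv \<epsilon> (t j))
      * (\<Prod>k\<in>UNIV. des_F (des_delta (\<xi> $ k)) (\<xi> $ k)
                     (\<Sum>j\<in>UNIV. \<gamma> $ j $ k * hankel \<epsilon> (t j))))"

text \<open>
  The prefactor is undefined as soon as some \<open>s\<^sub>j\<close> is an integer (at \<open>s\<^sub>j = 0, -1, \<dots>\<close> it has the
  form \<open>1 / (0 * \<infinity>)\<close>, at \<open>s\<^sub>j = 1, 2, \<dots>\<close> it has a pole).  The value of the entire function there is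
  obtained by continuation, i.e. as the limit along points with non-integral coordinates.
\<close>

definition zeta_des ::
  "real \<Rightarrow> complex^'r \<Rightarrow> complex^'r^'d \<Rightarrow> complex^'d \<Rightarrow> complex^'d \<Rightarrow> complex" where
  "zeta_des \<epsilon> \<xi> \<gamma> \<beta> s =
     Lim (at s within {z. \<forall>j. z $ j \<notin> \<int>})
       (\<lambda>z. 1 / (\<Prod>j\<in>UNIV. (exp (2 * of_real pi * \<i> * z $ j) - 1) * Gamma (z $ j))
            * hankel_integral \<epsilon> \<xi> \<gamma> \<beta> z)"

text \<open>
  The integrand has no singularity on the \<open>d\<close>-fold contour.  The singularities of
  \<open>F\<^sub>\<delta>(y, \<xi>)\<close> are the \<open>y\<close> with \<open>e\<^sup>y = \<xi>\<close>, apart from the removable one at \<open>y = 0\<close> for \<open>\<xi> = 1\<close>.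
\<close>

definition hankel_avoids_poles :: "real \<Rightarrow> complex^'r \<Rightarrow> complex^'r^'d \<Rightarrow> bool" where
  "hankel_avoids_poles \<epsilon> \<xi> \<gamma> \<longleftrightarrow>
     (\<forall>x k. (\<forall>j. x j \<in> range (hankel \<epsilon>)) \<longrightarrow>
        exp (\<Sum>j\<in>UNIV. \<gamma> $ j $ k * x j) = \<xi> $ k \<longrightarrow> (\<Sum>j\<in>UNIV. \<gamma> $ j $ k * x j) = 0)"

lemma hankel_cases:
  assumes "\<epsilon> > 0" "x \<in> range (hankel \<epsilon>)"
  obtains "norm x = \<epsilon>" | a where "a > \<epsilon>" "x = of_real a"
proof -
  obtain t where t: "x = hankel \<epsilon> t" using assms(2) by blast
  consider "t < 0" | "0 \<le> t" "t \<le> 2 * pi" | "t > 2 * pi" by linarith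
  then show ?thesis
  proof cases
    case 1
    then show ?thesis using that(2)[of "\<epsilon> - t"] assms(1) t by (simp add: hankel_eq)
  next
    case 2
    then show ?thesis using that(1) assms(1) t by (simp add: hankel_eq norm_mult)
  next
    case 3
    moreover have "t > 0" using 3 pi_gt_zero by linarith
    ultimately show ?thesis
      using that(2)[of "\<epsilon> + (t - 2 * pi)"] assms(1) t by (auto simp: hankel_eq)
  qed
qed

text \<open>
  Small contours do avoid the poles, except when \<open>|\<xi>\<^sub>k| = 1\<close> for some \<open>k\<close> such that some
  \<open>\<gamma>\<^sub>j\<^sub>k\<close> is purely imaginary and non-zero; in that case poles lie on the contour for every \<open>\<epsilon>\<close>.
\<close>

lemma eventually_hankel_avoids_poles:
  fixes \<xi> :: "complex^'r" and \<gamma> :: "complex^'r^'d"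
  assumes xi: "\<And>k. norm (\<xi> $ k) \<le> 1"
    and gam: "\<And>j k. Re (\<gamma> $ j $ k) \<ge> 0"
    and gam': "\<And>j k. norm (\<xi> $ k) = 1 \<Longrightarrow> \<gamma> $ j $ k = 0 \<or> Re (\<gamma> $ j $ k) > 0"
  shows "\<forall>\<^sub>F \<epsilon> in at_right 0. hankel_avoids_poles \<epsilon> \<xi> \<gamma>"
proof -
  let ?y = "\<lambda>x k. \<Sum>j\<in>UNIV. \<gamma> $ j $ k * x j"
  have lower: "Re (\<gamma> $ j $ k * z) \<ge> - \<epsilon> * norm (\<gamma> $ j $ k)"
    if "\<epsilon> > 0" "z \<in> range (hankel \<epsilon>)" for \<epsilon> z j k
    using that
  proof (cases rule: hankel_cases)
    case 1
    have "\<bar>Re (\<gamma> $ j $ k * z)\<bar> \<le> norm (\<gamma> $ j $ k) * \<epsilon>"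
      using abs_Re_le_cmod[of "\<gamma> $ j $ k * z"] 1 by (simp add: norm_mult)
    then show ?thesis by (simp add: abs_le_iff mult.commute)
  next
    case (2 a)
    then have "Re (\<gamma> $ j $ k * z) \<ge> 0" using gam[of j k] that(1) by simp
    moreover have "\<epsilon> * norm (\<gamma> $ j $ k) \<ge> 0" using that(1) by simp
    ultimately show ?thesis by linarith
  qed
  have "\<forall>\<^sub>F \<epsilon> in at_right 0. \<forall>x. (\<forall>j. x j \<in> range (hankel \<epsilon>)) \<longrightarrow>
      exp (?y x k) = \<xi> $ k \<longrightarrow> ?y x k = 0" for k
  proof -
    define G where "G = (\<Sum>j\<in>UNIV. norm (\<gamma> $ j $ k))"
    have G0: "G \<ge> 0" by (simp add: G_def sum_nonneg)
    have Gj: "norm (\<gamma> $ j $ k) \<le> G" for j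
      unfolding G_def by (rule member_le_sum) auto
    have lowy: "Re (?y x k) \<ge> - \<epsilon> * G"
      if "\<epsilon> > 0" "\<forall>j. x j \<in> range (hankel \<epsilon>)" for \<epsilon> x
    proof -
      have "- \<epsilon> * G = (\<Sum>j\<in>UNIV. - \<epsilon> * norm (\<gamma> $ j $ k))"
        by (simp only: G_def sum_distrib_left)
      also have "\<dots> \<le> (\<Sum>j\<in>UNIV. Re (\<gamma> $ j $ k * x j))"
        by (rule sum_mono) (use lower that in blast)
      finally show ?thesis by simp
    qed
    show ?thesis
    proof (cases "norm (\<xi> $ k) = 1")
      case False
      then have lt: "norm (\<xi> $ k) < 1" using xi[of k] by linarith
      show ?thesis
      proof (cases "\<xi> $ k = 0")
        case True
        then show ?thesis by simp
      next
        case nz: False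
        define c where "c = - ln (norm (\<xi> $ k))"
        have c: "c > 0" using lt nz by (simp add: c_def)
        have "\<forall>\<^sub>F \<epsilon> in at_right 0. \<epsilon> > 0 \<and> \<epsilon> < c / (G + 1)"
          using c G0 by (auto simp: eventually_at_right_field intro!: exI[of _ "c / (G + 1)"])
        then show ?thesis
        proof eventually_elim
          case (elim \<epsilon>)
          have "\<epsilon> * G < c"
          proof -
            have "\<epsilon> * (G + 1) < c" using elim G0 by (simp add: field_simps)
            then show ?thesis using elim by (simp add: algebra_simps)
          qed
          moreover have "Re (?y x k) = - c" if "exp (?y x k) = \<xi> $ k" for x
          proof -
            have "exp (Re (?y x k)) = norm (\<xi> $ k)"
              by (metis that norm_exp_eq_Re)
            then show ?thesis unfolding c_def by (metis ln_exp minus_minus)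
          qed
          ultimately have "\<not> exp (?y x k) = \<xi> $ k"
            if "\<forall>j. x j \<in> range (hankel \<epsilon>)" for x
            using lowy[OF _ that] elim by force
          then show ?case by blast
        qed
      qed
    next
      case True
      define K where "K = (\<Sum>j\<in>UNIV. norm (\<gamma> $ j $ k) * (1 + G / Re (\<gamma> $ j $ k)))"
      have K0: "K \<ge> 0" unfolding K_def using gam G0 by (intro sum_nonneg) simp
      obtain \<rho> where \<rho>: "\<rho> > 0" "\<And>y. norm y < \<rho> \<Longrightarrow> exp y = \<xi> $ k \<Longrightarrow> y = 0"
      proof (cases "\<xi> $ k = 1")
        case True
        have "y = 0" if "norm y < 2 * pi" "exp y = \<xi> $ k" for y
        proof -
          have "exp y = 1" using that True by simp
          then obtain n :: int where n: "Re y = 0" "Im y = of_int (2 * n) * pi"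
            unfolding exp_eq_1 by blast
          have "\<bar>of_int (2 * n) * pi\<bar> < 2 * pi"
            using abs_Im_le_cmod[of y] that n by simp
          then have "\<bar>real_of_int n\<bar> < 1" by (simp add: abs_mult)
          then have "n = 0" by linarith
          then show ?thesis using n by (simp add: complex_eq_iff)
        qed
        then show ?thesis using that[of "2 * pi"] by simp
      next
        case False
        have "((\<lambda>y::complex. exp y) \<longlongrightarrow> exp 0) (nhds 0)"
          by (intro tendsto_intros) (simp add: filterlim_ident)
        then have "\<forall>\<^sub>F y in nhds 0. exp y \<noteq> \<xi> $ k"
          using False by (intro tendsto_imp_eventually_ne) auto
        then show ?thesis using that by (auto simp: eventually_nhds_metric)
      qed
      have "\<forall>\<^sub>F \<epsilon> in at_right 0. \<epsilon> > 0 \<and> \<epsilon> < \<rho> / (K + 1)"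
        using \<rho> K0 by (auto simp: eventually_at_right_field intro!: exI[of _ "\<rho> / (K + 1)"])
      then show ?thesis
      proof eventually_elim
        case (elim \<epsilon>)
        show ?case
        proof (intro allI impI)
          fix x assume x: "\<forall>j. x j \<in> range (hankel \<epsilon>)" and e: "exp (?y x k) = \<xi> $ k"
          have "exp (Re (?y x k)) = 1" by (metis e True norm_exp_eq_Re)
          then have re0: "(\<Sum>j\<in>UNIV. Re (\<gamma> $ j $ k * x j)) = 0" by simp
          have upper: "Re (\<gamma> $ j $ k * x j) \<le> \<epsilon> * G" for j
          proof -
            have "- \<epsilon> * G \<le> (\<Sum>i\<in>UNIV-{j}. - \<epsilon> * norm (\<gamma> $ i $ k))"
            proof -
              have "(\<Sum>i\<in>UNIV-{j}. norm (\<gamma> $ i $ k)) \<le> G"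
                unfolding G_def by (rule sum_mono2) auto
              then have "\<epsilon> * (\<Sum>i\<in>UNIV-{j}. norm (\<gamma> $ i $ k)) \<le> \<epsilon> * G"
                using elim by simp
              then show ?thesis by (simp add: sum_distrib_left sum_negf)
            qed
            also have "\<dots> \<le> (\<Sum>i\<in>UNIV-{j}. Re (\<gamma> $ i $ k * x i))"
              by (rule sum_mono) (use lower elim x in blast)
            also have "\<dots> = - Re (\<gamma> $ j $ k * x j)"
              using re0 sum.remove[of UNIV j "\<lambda>j. Re (\<gamma> $ j $ k * x j)"] by simp
            finally show ?thesis by simp
          qed
          have bnd: "norm (\<gamma> $ j $ k * x j) \<le> \<epsilon> * (norm (\<gamma> $ j $ k) * (1 + G / Re (\<gamma> $ j $ k)))" for j
          proof (cases "\<gamma> $ j $ k = 0")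
            case nz: False
            then have g: "Re (\<gamma> $ j $ k) > 0" using gam' True by blast
            have "norm (x j) \<le> \<epsilon> * (1 + G / Re (\<gamma> $ j $ k))"
            proof -
              have p: "\<epsilon> * (G / Re (\<gamma> $ j $ k)) \<ge> 0" using elim G0 g by simp
              from elim have "\<epsilon> > 0" by simp
              from this x[rule_format, of j] show ?thesis
              proof (cases rule: hankel_cases)
                case 1
                then show ?thesis using p by (simp add: algebra_simps)
              next
                case (2 a)
                have "Re (\<gamma> $ j $ k) * a \<le> \<epsilon> * G" using upper[of j] 2 by simp
                then have "a \<le> \<epsilon> * (G / Re (\<gamma> $ j $ k))" using g by (simp add: field_simps)
                moreover have "norm (x j) = a" using 2 elim by simp
                ultimately show ?thesis using elim unfolding distrib_left by linarith
              qed
            qed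
            then have "norm (\<gamma> $ j $ k) * norm (x j) \<le>
                norm (\<gamma> $ j $ k) * (\<epsilon> * (1 + G / Re (\<gamma> $ j $ k)))"
              by (rule mult_left_mono) simp
            then show ?thesis by (simp add: norm_mult mult.left_commute)
          qed simp
          have "norm (?y x k) \<le> (\<Sum>j\<in>UNIV. \<epsilon> * (norm (\<gamma> $ j $ k) * (1 + G / Re (\<gamma> $ j $ k))))"
            by (rule sum_norm_le) (rule bnd)
          also have "\<dots> = \<epsilon> * K" by (simp only: K_def sum_distrib_left)
          also have "\<dots> < \<rho>"
          proof -
            have "\<epsilon> * (K + 1) < \<rho>" using elim K0 by (simp add: field_simps)
            then show ?thesis using elim by (simp add: algebra_simps)
          qed
          finally show "?y x k = 0" using \<rho>(2) e by blast
        qed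
      qed
    qed
  qed
  then have "\<forall>\<^sub>F \<epsilon> in at_right 0. \<forall>k. \<forall>x. (\<forall>j. x j \<in> range (hankel \<epsilon>)) \<longrightarrow>
      exp (?y x k) = \<xi> $ k \<longrightarrow> ?y x k = 0"
    by (simp add: eventually_all_finite)
  then show ?thesis
    by eventually_elim (auto simp: hankel_avoids_poles_def)
qed

end

theory Submission
  imports Defs "HOL-Probability.Sinc_Integral"
begin

text \<open>
  On the \<open>d\<close>-fold contour \<open>F\<^sub>\<delta>(y, \<xi>\<^sub>k)\<close> is \<open>O((1 + |y|) exp (- Re y))\<close>, which cancels the factor with
  \<open>\<Sum>\<^sub>k \<gamma>\<^sub>j\<^sub>k\<close> in the exponent and leaves the decay of \<open>exp (- \<beta>\<^sub>j x\<^sub>j)\<close>.  By dominated convergence the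
  contour integral is therefore continuous in \<open>s\<close>, while each factor of the prefactor tends to
  \<open>(-1)\<^sup>\<lambda> \<lambda>! / (2 \<pi> i)\<close> as \<open>s \<rightarrow> -\<lambda>\<close>.  At \<open>s = -\<lambda>\<close> the integrand is single valued, so the two sides
  of the positive axis cancel in every variable and only a torus of radius \<open>\<epsilon>\<close> remains.  There the
  integral extracts the Taylor coefficient of \<open>\<Prod>\<^sub>j x\<^sub>j ^ \<lambda>\<^sub>j\<close>, which the multinomial theorem computes.
\<close>

subsection \<open>The function F\<close>

text \<open>Avoiding the poles keeps F finite at each point of the contour, but dominated
  convergence on an unbounded contour needs a bound that is uniform in all variables. If |\<xi>_k| <
  1, such a bound holds on a half-plane Re y >= c with c slightly negative, and small contours keep
  the argument there. If |\<xi>_k| = 1, the poles lie on the imaginary axis. Here the hypothesis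
  that small contours avoid the poles does more than it says: it forces each
  \<open>\<gamma> $ j $ k\<close> to be 0 or to have positive real part. The arguments then lie in a
  cone around the positive real axis, thickened by a multiple of \<epsilon>. This region meets the
  imaginary axis only near 0, where the singularity is absent or removable. A further bound on
  \<epsilon> puts the torus inside the discs of convergence of the Taylor series of F.\<close>

lemma des_F_formula_analytic:
  assumes "exp y \<noteq> \<xi>"
  shows "(\<lambda>y. 1 / (exp y - \<xi>) - of_nat (des_delta \<xi>) * (y * exp y / (exp y - 1)\<^sup>2)) analytic_on {y}"
proof (cases "\<xi> = 1")
  case True
  then show ?thesis using assms by (auto intro!: analytic_intros)
next
  case False
  then have "(\<lambda>y. 1 / (exp y - \<xi>) - of_nat (des_delta \<xi>) * (y * exp y / (exp y - 1)\<^sup>2))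
    = (\<lambda>y. 1 / (exp y - \<xi>))" by (simp add: des_delta_def)
  then show ?thesis using assms by (auto intro!: analytic_intros)
qed

lemma des_F_eq:
  assumes "exp y \<noteq> \<xi>"
  shows "des_F (des_delta \<xi>) \<xi> y =
    1 / (exp y - \<xi>) - of_nat (des_delta \<xi>) * (y * exp y / (exp y - 1)\<^sup>2)"
  unfolding des_F_def using des_F_formula_analytic[OF assms] by (rule remove_sings_at_analytic)

text \<open>The solutions of exp y = 1 are the multiples of 2 pi i; for any other \<xi>, 0 is not a
  solution and continuity keeps a neighbourhood free of solutions. The radius serves both as that of
  a disc for the Taylor series and as the height allowed to the cone at the imaginary axis.\<close>

lemma exp_eq_isolated_at_0:
  fixes \<xi> :: complex
  obtains \<rho> where "\<rho> > 0" "\<And>y. norm y < \<rho> \<Longrightarrow> exp y = \<xi> \<Longrightarrow> y = 0"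
proof (cases "\<xi> = 1")
  case True
  have "y = 0" if "norm y < 1" "exp y = \<xi>" for y :: complex
    using exp_complex_eqI[of y 0] that True abs_Im_le_cmod[of y] pi_gt3 by auto
  then show ?thesis using that[of 1] by simp
next
  case False
  have "((\<lambda>y::complex. exp y) \<longlongrightarrow> exp 0) (nhds 0)"
    by (intro tendsto_intros) (simp add: filterlim_ident)
  then have "\<forall>\<^sub>F y in nhds 0. exp y \<noteq> \<xi>"
    using False by (intro tendsto_imp_eventually_ne) auto
  then show ?thesis using that by (auto simp: eventually_nhds_metric)
qed

text \<open>The only delicate point is y = 0 with \<xi> = 1. Over the common denominator (exp y -
  1)^2, the numerator vanishes to second order as well, so the quotient has a limit and the
  singularity is removable.\<close>

lemma des_F_analytic:
  "des_F (des_delta \<xi>) \<xi> analytic_on {y. exp y = \<xi> \<longrightarrow> y = 0}"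
proof -
  define f where
    "f y = 1 / (exp y - \<xi>) - of_nat (des_delta \<xi>) * (y * exp y / (exp y - 1)\<^sup>2)" for y
  have an: "f analytic_on {y}" if "exp y \<noteq> \<xi>" for y
    unfolding f_def[abs_def] using des_F_formula_analytic[OF that] .
  have F: "des_F (des_delta \<xi>) \<xi> = remove_sings f"
    by (simp add: des_F_def f_def[abs_def])
  have "remove_sings f analytic_on {0}" if "\<xi> = 1"
  proof (rule remove_sings_analytic_at)
    \<comment> \<open>\<open>h\<close> is (exp z - 1) / z, \<open>N\<close> is the numerator of F
      over (exp z - 1)^2, and \<open>N1\<close>, \<open>N2\<close> divide \<open>N\<close> by z once
      and twice. The values at 0 are derivatives, the form in which \<open>pole_lemma_open\<close>
      yields holomorphy.\<close>
    define h where "h z = (if z = 0 then deriv exp 0 else (exp z - exp 0) / (z - 0))" for z :: complex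
    define N where "N z = exp z - 1 - z * exp z" for z :: complex
    define N1 where "N1 z = (if z = 0 then deriv N 0 else (N z - N 0) / (z - 0))" for z
    define N2 where "N2 z = (if z = 0 then deriv N1 0 else (N1 z - N1 0) / (z - 0))" for z
    have h: "h holomorphic_on UNIV"
      unfolding h_def[abs_def] by (rule pole_lemma_open) (auto intro!: holomorphic_intros)
    have "N holomorphic_on UNIV" unfolding N_def[abs_def] by (intro holomorphic_intros)
    then have "N1 holomorphic_on UNIV"
      unfolding N1_def[abs_def] by (rule pole_lemma_open) auto
    then have N2: "N2 holomorphic_on UNIV"
      unfolding N2_def[abs_def] by (rule pole_lemma_open) auto
    have "(N has_field_derivative 0) (at 0)"
      unfolding N_def[abs_def] by (auto intro!: derivative_eq_intros)
    \<comment> \<open>Hence \<open>N1 0 = 0\<close>, which makes \<open>N2\<close> equal to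
      \<open>N\<close> divided by z^2 away from 0.\<close>
    then have dN: "deriv N 0 = 0" by (rule DERIV_imp_deriv)
    have h0: "h 0 = 1" using DERIV_imp_deriv[OF DERIV_exp[of "0::complex"]] by (simp add: h_def)
    obtain \<rho> where \<rho>: "\<rho> > 0" "\<And>y::complex. norm y < \<rho> \<Longrightarrow> exp y = 1 \<Longrightarrow> y = 0"
      using exp_eq_isolated_at_0[of 1] by blast
    have eq: "N2 y / (h y)\<^sup>2 = f y" if "y \<noteq> 0" "norm y < \<rho>" for y
    proof -
      have e: "exp y \<noteq> 1" using \<rho> that by blast
      have "N2 y = N y / y\<^sup>2" "h y = (exp y - 1) / y"
        using that by (simp_all add: N2_def N1_def dN h_def N_def[of 0] power2_eq_square)
      then have "N2 y / (h y)\<^sup>2 = N y / (exp y - 1)\<^sup>2"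
        using that by (simp add: power_divide)
      also have "\<dots> = (exp y - 1) / (exp y - 1)\<^sup>2 - y * exp y / (exp y - 1)\<^sup>2"
        unfolding N_def by (rule diff_divide_distrib)
      also have "(exp y - 1) / (exp y - 1)\<^sup>2 = 1 / (exp y - 1)"
        using e by (simp add: power2_eq_square)
      also have "1 / (exp y - 1) - y * exp y / (exp y - 1)\<^sup>2 = f y"
        using \<open>\<xi> = 1\<close> by (simp add: f_def des_delta_def)
      finally show ?thesis .
    qed
    have "isCont (\<lambda>y. N2 y / (h y)\<^sup>2) 0"
      using N2 h h0 by (intro continuous_intros)
        (auto simp: holomorphic_on_imp_continuous_on continuous_on_eq_continuous_at
          dest!: holomorphic_on_imp_continuous_on)
    then have "(\<lambda>y. N2 y / (h y)\<^sup>2) \<midarrow>0\<rightarrow> N2 0 / (h 0)\<^sup>2" by (simp add: isCont_def)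
    then show "f \<midarrow>0\<rightarrow> N2 0 / (h 0)\<^sup>2"
      by (rule Lim_transform_within[OF _ \<rho>(1)]) (use eq in auto)
    show "isolated_singularity_at f 0"
    proof -
      have "f analytic_on {y}" if "y \<in> ball 0 \<rho> - {0}" for y
        using that \<rho>(2)[of y] \<open>\<xi> = 1\<close> by (intro an) auto
      then have "f analytic_on ball 0 \<rho> - {0}" by (subst analytic_on_analytic_at) blast
      then show ?thesis using \<rho>(1) unfolding isolated_singularity_at_def by blast
    qed
  qed
  then have "remove_sings f analytic_on {y}" if "exp y = \<xi> \<longrightarrow> y = 0" for y
    using that an[THEN remove_sings_analytic_on, of y] by (cases "exp y = \<xi>") auto
  then show ?thesis unfolding F by (subst analytic_on_analytic_at) blast
qed

lemma des_F_sums: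
  assumes "\<And>y. norm y < \<rho> \<Longrightarrow> exp y = \<xi> \<Longrightarrow> y = 0" "norm z < \<rho>"
  shows "(\<lambda>n. des_F_coeff (des_delta \<xi>) \<xi> n / fact n * z ^ n) sums des_F (des_delta \<xi>) \<xi> z"
proof -
  have "ball 0 \<rho> \<subseteq> {y. exp y = \<xi> \<longrightarrow> y = 0}" using assms(1) by auto
  then have "des_F (des_delta \<xi>) \<xi> holomorphic_on ball 0 \<rho>"
    by (intro analytic_imp_holomorphic[OF analytic_on_subset[OF des_F_analytic]])
  from holomorphic_power_series[OF this, of z] show ?thesis
    using assms(2) by (simp add: des_F_coeff_def)
qed

section \<open>Exponential bounds for F\<close>

text \<open>On the half-plane, |\<xi>| = q exp c <= q exp (Re y) with q < 1, so |exp y - \<xi>| is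
  at least (1 - q) exp (Re y). In the application c is a small negative number. The factor
  \<open>1 + norm y\<close> gives the bound the same shape as in
  \<open>des_F_bound_cone\<close>.\<close>

lemma des_F_bound_inside:
  fixes \<xi> :: complex
  assumes "norm \<xi> < 1" "norm \<xi> < exp c"
  obtains C where "C > 0" "\<And>y. Re y \<ge> c \<Longrightarrow> norm (des_F (des_delta \<xi>) \<xi> y) \<le> C * (1 + norm y) * exp (- Re y)"
proof -
  define q where "q = norm \<xi> / exp c"
  have q: "q < 1" "q \<ge> 0" using assms by (auto simp: q_def)
  have "norm (des_F (des_delta \<xi>) \<xi> y) \<le> 1 / (1 - q) * (1 + norm y) * exp (- Re y)" if "Re y \<ge> c" for y
  proof -
    have x1: "\<xi> \<noteq> 1" using assms by auto
    have "norm \<xi> = q * exp c" by (simp add: q_def)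
    also have "\<dots> \<le> q * exp (Re y)" using that q by (intro mult_left_mono) auto
    finally have le: "(1 - q) * exp (Re y) \<le> exp (Re y) - norm \<xi>" by (simp add: algebra_simps)
    also have "\<dots> \<le> norm (exp y - \<xi>)"
      using norm_triangle_ineq2[of "exp y" \<xi>] by (simp add: norm_exp_eq_Re)
    finally have le: "(1 - q) * exp (Re y) \<le> norm (exp y - \<xi>)" .
    have p: "0 < (1 - q) * exp (Re y)" using q by simp
    then have ne: "exp y \<noteq> \<xi>" using le by auto
    have "norm (des_F (des_delta \<xi>) \<xi> y) = 1 / norm (exp y - \<xi>)"
      unfolding des_F_eq[OF ne] using x1 by (simp add: des_delta_def norm_divide)
    also have "\<dots> \<le> 1 / ((1 - q) * exp (Re y))"
      using le p by (intro divide_left_mono) (auto intro!: mult_pos_pos)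
    also have "\<dots> = 1 / (1 - q) * 1 * exp (- Re y)" by (simp add: exp_minus field_simps)
    also have "\<dots> \<le> 1 / (1 - q) * (1 + norm y) * exp (- Re y)"
      using q by (intro mult_right_mono mult_left_mono) auto
    finally show ?thesis .
  qed
  then show ?thesis using that[of "1 / (1 - q)"] q by auto
qed

text \<open>Solutions of exp y = \<xi> are purely imaginary, and on the imaginary axis the region
  allows only |y| <= B < \<rho>, hence only y = 0, where F is analytic. The part with Re y <= 1 is
  compact, so F is bounded there by continuity; beyond it, exp y dominates in the
  denominators.\<close>

lemma des_F_bound_cone:
  fixes \<xi> :: complex
  assumes "norm \<xi> = 1" "\<And>y. norm y < \<rho> \<Longrightarrow> exp y = \<xi> \<Longrightarrow> y = 0" "B < \<rho>"
  obtains C where "C > 0"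
    "\<And>y. Re y \<ge> A \<Longrightarrow> \<bar>Im y\<bar> \<le> M * Re y + B \<Longrightarrow>
      norm (des_F (des_delta \<xi>) \<xi> y) \<le> C * (1 + norm y) * exp (- Re y)"
proof -
  define K where "K = {y. A \<le> Re y \<and> Re y \<le> 1 \<and> \<bar>Im y\<bar> \<le> M * Re y + B}"
  have "closed K" unfolding K_def
    by (intro closed_Collect_conj closed_Collect_le continuous_intros)
  moreover have "norm y \<le> (\<bar>A\<bar> + 1) + (\<bar>M\<bar> * (\<bar>A\<bar> + 1) + \<bar>B\<bar>)" if "y \<in> K" for y
  proof -
    have r: "\<bar>Re y\<bar> \<le> \<bar>A\<bar> + 1" using that by (auto simp: K_def)
    have "M * Re y \<le> \<bar>M\<bar> * \<bar>Re y\<bar>" by (metis abs_ge_self abs_mult)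
    also have "\<dots> \<le> \<bar>M\<bar> * (\<bar>A\<bar> + 1)" using r by (intro mult_left_mono) auto
    finally have "\<bar>Im y\<bar> \<le> \<bar>M\<bar> * (\<bar>A\<bar> + 1) + \<bar>B\<bar>" using that by (auto simp: K_def)
    then show ?thesis using cmod_le[of y] r by linarith
  qed
  then have "bounded K" by (auto simp: bounded_iff)
  ultimately have "compact K" by (simp add: compact_eq_bounded_closed)
  have "K \<subseteq> {y. exp y = \<xi> \<longrightarrow> y = 0}"
  proof (clarify)
    fix y assume y: "y \<in> K" "\<xi> = exp y"
    have "exp (Re y) = 1" using y assms(1) by (metis norm_exp_eq_Re)
    then have "Re y = 0" by simp
    then have "norm y \<le> B" using y cmod_le[of y] by (auto simp: K_def)
    then show "y = 0" using assms(2,3) y by auto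
  qed
  then have "continuous_on K (des_F (des_delta \<xi>) \<xi>)"
    by (intro holomorphic_on_imp_continuous_on analytic_imp_holomorphic
      analytic_on_subset[OF des_F_analytic])
  then have "bounded (des_F (des_delta \<xi>) \<xi> ` K)"
    using \<open>compact K\<close> compact_continuous_image compact_imp_bounded by blast
  then obtain D where D: "D > 0" "\<And>y. y \<in> K \<Longrightarrow> norm (des_F (des_delta \<xi>) \<xi> y) \<le> D"
    by (auto simp: bounded_pos)
  \<comment> \<open>On the compact part exp (- Re y) >= exp (- 1), which accounts for
    \<open>D * exp 1\<close>. The far part gives 2 + 4 |y| <= 6 (1 + |y|).\<close>
  define C where "C = D * exp 1 + 6"
  have "norm (des_F (des_delta \<xi>) \<xi> y) \<le> C * (1 + norm y) * exp (- Re y)"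
    if y: "Re y \<ge> A" "\<bar>Im y\<bar> \<le> M * Re y + B" for y
  proof (cases "Re y \<le> 1")
    case True
    then have "norm (des_F (des_delta \<xi>) \<xi> y) \<le> D" using D y by (auto simp: K_def)
    also have "\<dots> \<le> D * exp 1 * 1 * exp (- Re y)"
      using D True by (simp add: mult_exp_exp mult.assoc)
    also have "\<dots> \<le> C * (1 + norm y) * exp (- Re y)"
      using D by (intro mult_right_mono mult_mono) (auto simp: C_def)
    finally show ?thesis .
  next
    case False
    have "2 \<le> exp (1::real)" using exp_ge_add_one_self[of 1] by simp
    also have "exp 1 \<le> exp (Re y)" using False by simp
    finally have e2: "2 \<le> exp (Re y)" .
    \<comment> \<open>Needed for \<open>\<eta> = \<xi>\<close> in the first summand of F and for
      \<open>\<eta> = 1\<close> in the squared denominator.\<close>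
    have low: "exp (Re y) / 2 \<le> norm (exp y - \<eta>)" if "norm \<eta> = 1" for \<eta>
      using norm_triangle_ineq2[of "exp y" \<eta>] that e2 by (simp add: norm_exp_eq_Re)
    have ne: "exp y \<noteq> \<xi>" using low[of \<xi>] assms e2 by auto
    have "norm (1 / (exp y - \<xi>)) \<le> 1 / (exp (Re y) / 2)"
      unfolding norm_divide norm_one
      using low[of \<xi>] assms e2 by (intro divide_left_mono mult_pos_pos) auto
    then have 1: "norm (1 / (exp y - \<xi>)) \<le> 2 * exp (- Re y)"
      by (simp add: exp_minus field_simps)
    have "norm (y * exp y / (exp y - 1)\<^sup>2) = norm y * exp (Re y) / (norm (exp y - 1))\<^sup>2"
      by (simp add: norm_divide norm_mult norm_power norm_exp_eq_Re)
    also have "\<dots> \<le> norm y * exp (Re y) / (exp (Re y) / 2)\<^sup>2"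
      using low[of 1] e2 by (intro divide_left_mono power_mono mult_pos_pos) auto
    also have "\<dots> = 4 * norm y * exp (- Re y)"
      by (simp add: exp_minus field_simps power2_eq_square)
    finally have 2: "norm (y * exp y / (exp y - 1)\<^sup>2) \<le> 4 * norm y * exp (- Re y)" .
    have "norm (des_F (des_delta \<xi>) \<xi> y) \<le>
        norm (1 / (exp y - \<xi>)) + norm (y * exp y / (exp y - 1)\<^sup>2)"
      using ne norm_triangle_ineq4[of "1 / (exp y - \<xi>)" "y * exp y / (exp y - 1)\<^sup>2"]
      unfolding des_F_eq[OF ne] by (auto simp: des_delta_def)
    also have "\<dots> \<le> 2 * exp (- Re y) + 4 * norm y * exp (- Re y)" using 1 2 by linarith
    also have "\<dots> = (2 + 4 * norm y) * exp (- Re y)" by (simp add: algebra_simps)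
    also have "\<dots> \<le> C * (1 + norm y) * exp (- Re y)"
    proof (rule mult_right_mono)
      have "2 + 4 * norm y \<le> 6 * (1 + norm y)" by simp
      also have "\<dots> \<le> C * (1 + norm y)"
        using D by (intro mult_right_mono) (auto simp: C_def)
      finally show "2 + 4 * norm y \<le> C * (1 + norm y)" .
    qed simp
    finally show ?thesis .
  qed
  moreover have "C > 0" using D by (simp add: C_def add_pos_pos)
  ultimately show ?thesis using that by blast
qed

subsection \<open>The Hankel contour\<close>

lemma norm_hankel:
  assumes "\<epsilon> > 0"
  shows "norm (hankel \<epsilon> t) = (if t < 0 then \<epsilon> - t else if t \<le> 2 * pi then \<epsilon> else \<epsilon> + (t - 2 * pi))"
  using assms pi_gt_zero by (auto simp: hankel_eq norm_mult simp del: pi_gt_zero of_real_diff of_real_add)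

lemma norm_hankel_ge: "\<epsilon> > 0 \<Longrightarrow> \<epsilon> \<le> norm (hankel \<epsilon> t)"
  by (auto simp: norm_hankel)

text \<open>Converts decay in the modulus of the contour point into decay in the parameter t, the
  variable of integration.\<close>

lemma abs_le_norm_hankel: "\<epsilon> > 0 \<Longrightarrow> \<bar>t\<bar> \<le> 2 * pi + norm (hankel \<epsilon> t)"
  using pi_gt_zero by (auto simp: norm_hankel abs_if simp del: pi_gt_zero)

lemma norm_hankel_deriv_le: "\<epsilon> > 0 \<Longrightarrow> norm (hankel_deriv \<epsilon> t) \<le> 1 + \<epsilon>"
  by (auto simp: hankel_deriv_def norm_mult norm_hankel)

lemma norm_hankel_log_le:
  assumes "\<epsilon> > 0"
  shows "norm (hankel_log \<epsilon> t) \<le> \<bar>ln (norm (hankel \<epsilon> t))\<bar> + 2 * pi"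
proof -
  have "norm (complex_of_real a + \<i> * of_real b) \<le> \<bar>a\<bar> + 2 * pi" if "0 \<le> b" "b \<le> 2 * pi" for a b
    using norm_triangle_ineq[of "complex_of_real a" "\<i> * of_real b"] that by (simp add: norm_mult)
  from this[of "2 * pi"] this[of t] show ?thesis
    using assms by (auto simp: hankel_log_def norm_hankel mult.commute)
qed

lemma hankel_log_measurable [measurable]: "hankel_log \<epsilon> \<in> borel_measurable borel"
  unfolding hankel_log_def by measurable

lemma hankel_measurable [measurable]: "hankel \<epsilon> \<in> borel_measurable borel"
  unfolding hankel_def by measurable

lemma hankel_deriv_measurable [measurable]: "hankel_deriv \<epsilon> \<in> borel_measurable borel"
  unfolding hankel_deriv_def by measurable

lemma circle_in_range_hankel:
  assumes "\<epsilon> > 0" "norm x = \<epsilon>"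
  shows "x \<in> range (hankel \<epsilon>)"
proof -
  have "x = hankel \<epsilon> (Arg2pi x)"
    using Arg2pi[of x] assms by (simp add: hankel_eq is_Arg_def)
  then show ?thesis by blast
qed

lemma real_in_range_hankel:
  assumes "\<epsilon> > 0" "a > \<epsilon>"
  shows "complex_of_real a \<in> range (hankel \<epsilon>)"
proof -
  have "complex_of_real a = hankel \<epsilon> (\<epsilon> - a)" using assms by (simp add: hankel_eq)
  then show ?thesis by blast
qed

text \<open>The reflection t -> 2 pi - t exchanges the two sides of the positive axis, which are
  traversed in opposite directions.\<close>

lemma hankel_flip:
  assumes "\<epsilon> > 0" "t < 0 \<or> t > 2 * pi"
  shows "hankel \<epsilon> (2 * pi - t) = hankel \<epsilon> t"
    and "hankel_deriv \<epsilon> (2 * pi - t) = - hankel_deriv \<epsilon> t"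
  using assms pi_gt_zero by (auto simp: hankel_eq hankel_deriv_def simp del: pi_gt_zero)

section \<open>An integrable majorant in one variable\<close>

text \<open>With q >= 1 and q >= n / b one has 1 + a <= q (1 + b a / n) <= q exp (b a / n); the n-th
  power of this gives \<open>D = q ^ n\<close>.\<close>

lemma power_le_exp:
  fixes b :: real
  assumes "b > 0"
  obtains D where "D > 0" "\<And>a. a \<ge> 0 \<Longrightarrow> (1 + a) ^ n \<le> D * exp (b * a)"
proof (cases "n = 0")
  case True
  then show ?thesis using that[of 1] assms by auto
next
  case False
  define q where "q = max 1 (n / b)"
  have q: "q \<ge> 1" "q * b \<ge> n" using assms by (auto simp: q_def max_def field_simps)
  have "(1 + a) ^ n \<le> q ^ n * exp (b * a)" if "a \<ge> 0" for a
  proof -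
    have "a \<le> q * (b * a / n)"
      using mult_right_mono[OF q(2) that] False by (simp add: field_simps)
    then have "1 + a \<le> q * (1 + b * a / n)" using q by (simp add: distrib_left)
    also have "\<dots> \<le> q * exp (b * a / n)" using q by (intro mult_left_mono) auto
    finally have "(1 + a) ^ n \<le> (q * exp (b * a / n)) ^ n" using that by (intro power_mono) auto
    also have "\<dots> = q ^ n * exp (b * a)"
      using False by (simp add: power_mult_distrib flip: exp_of_nat_mult)
    finally show ?thesis .
  qed
  then show ?thesis using that[of "q ^ n"] q by auto
qed

text \<open>The power of x grows at most like (1 + |x|)^p, uniformly for s in the disc, and the
  decay of exp (- \<beta> x) on the rays beats any polynomial. The exponent \<open>r\<close> leaves
  room for one factor 1 + |x| from each of the functions F.\<close>

lemma hankel_factor_bound: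
  fixes \<beta> :: complex
  assumes e: "\<epsilon> > 0" and b: "Re \<beta> > 0"
  obtains C where "C > 0"
    "\<And>s t. norm (s - 1) \<le> of_nat p \<Longrightarrow>
      norm (exp ((s - 1) * hankel_log \<epsilon> t)) * exp (- Re (\<beta> * hankel \<epsilon> t)) *
      norm (hankel_deriv \<epsilon> t) * (1 + norm (hankel \<epsilon> t)) ^ r \<le> C * inverse (1 + t\<^sup>2)"
proof -
  obtain D where D: "D > 0" "\<And>a. a \<ge> 0 \<Longrightarrow> (1 + a) ^ (p + r + 2) \<le> D * exp (Re \<beta> * a)"
    using power_le_exp[OF b] by blast
  \<comment> \<open>\<open>E1\<close> absorbs the part of the logarithm that does not grow, and
    \<open>E2\<close> the circle, where Re (\<beta> x) may be negative. The exponent p + r + 2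
    chosen for \<open>D\<close> leaves (1 + a)^(-2). As 2 pi < 8, |t| <= 8 (1 + a), and 65 = 1 + 8^2
    turns (1 + a)^(-2) into 1 / (1 + t^2).\<close>
  define E1 where "E1 = exp (p * (\<bar>ln \<epsilon>\<bar> + 2 * pi))"
  define E2 where "E2 = exp ((norm \<beta> + Re \<beta>) * \<epsilon>)"
  define C where "C = E1 * E2 * (1 + \<epsilon>) * D * 65"
  have pos: "E1 > 0" "E2 > 0" "C > 0" using D e by (auto simp: E1_def E2_def C_def)
  have "norm (exp ((s - 1) * hankel_log \<epsilon> t)) * exp (- Re (\<beta> * hankel \<epsilon> t)) *
      norm (hankel_deriv \<epsilon> t) * (1 + norm (hankel \<epsilon> t)) ^ r \<le> C * inverse (1 + t\<^sup>2)"
    if s: "norm (s - 1) \<le> of_nat p" for s t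
  proof -
    define a where "a = norm (hankel \<epsilon> t)"
    have a: "a \<ge> \<epsilon>" "a > 0" using norm_hankel_ge[OF e, of t] e by (auto simp: a_def)
    \<comment> \<open>For a < 1 the logarithm is negative, and a >= \<epsilon> bounds it from
      below.\<close>
    have "\<bar>ln a\<bar> \<le> \<bar>ln \<epsilon>\<bar> + ln (1 + a)"
    proof (cases "a \<ge> 1")
      case True
      then have "0 \<le> ln a" "ln a \<le> ln (1 + a)" by auto
      then show ?thesis by linarith
    next
      case False
      then have "ln a \<le> 0" "ln \<epsilon> \<le> ln a" "0 \<le> ln (1 + a)" using a e by auto
      then show ?thesis by linarith
    qed
    then have l: "norm (hankel_log \<epsilon> t) \<le> (\<bar>ln \<epsilon>\<bar> + 2 * pi) + ln (1 + a)"
      using norm_hankel_log_le[OF e, of t] by (simp add: a_def)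
    have "Re ((s - 1) * hankel_log \<epsilon> t) \<le> norm (s - 1) * norm (hankel_log \<epsilon> t)"
      using complex_Re_le_cmod[of "(s - 1) * hankel_log \<epsilon> t"] by (simp only: norm_mult)
    also have "\<dots> \<le> of_nat p * ((\<bar>ln \<epsilon>\<bar> + 2 * pi) + ln (1 + a))"
      using s l by (intro mult_mono) auto
    finally have "norm (exp ((s - 1) * hankel_log \<epsilon> t)) \<le>
        exp (of_nat p * ((\<bar>ln \<epsilon>\<bar> + 2 * pi) + ln (1 + a)))"
      by (simp add: norm_exp_eq_Re)
    also have "\<dots> = E1 * (1 + a) ^ p"
      using a by (simp add: E1_def distrib_left exp_add exp_of_nat_mult)
    finally have 1: "norm (exp ((s - 1) * hankel_log \<epsilon> t)) \<le> E1 * (1 + a) ^ p" .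
    have "- Re (\<beta> * hankel \<epsilon> t) \<le> (norm \<beta> + Re \<beta>) * \<epsilon> - Re \<beta> * a"
      using e rangeI[of "hankel \<epsilon>" t]
    proof (cases rule: hankel_cases)
      case 1
      then have "- Re (\<beta> * hankel \<epsilon> t) \<le> norm \<beta> * \<epsilon>"
        using complex_Re_le_cmod[of "- (\<beta> * hankel \<epsilon> t)"] by (simp add: norm_mult)
      then show ?thesis using 1 by (simp add: a_def algebra_simps)
    next
      case (2 x)
      then have "- Re (\<beta> * hankel \<epsilon> t) = - Re \<beta> * a" using e by (simp add: a_def)
      moreover have "(norm \<beta> + Re \<beta>) * \<epsilon> \<ge> 0" using b e by simp
      ultimately show ?thesis by simp
    qed
    then have 2: "exp (- Re (\<beta> * hankel \<epsilon> t)) \<le> E2 * exp (- Re \<beta> * a)"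
      by (simp add: E2_def flip: exp_add)
    have d: "norm (hankel_deriv \<epsilon> t) \<le> 1 + \<epsilon>" using norm_hankel_deriv_le[OF e] .
    have "\<bar>t\<bar> \<le> 8 * (1 + a)"
      using abs_le_norm_hankel[OF e, of t] pi_less_4 a unfolding a_def[symmetric] distrib_left
      by linarith
    then have "t\<^sup>2 \<le> (8 * (1 + a))\<^sup>2" using power_mono[of "\<bar>t\<bar>" "8 * (1 + a)" 2] by simp
    moreover have "1 \<le> (1 + a)\<^sup>2" using a by simp
    ultimately have t2: "1 + t\<^sup>2 \<le> 65 * (1 + a)\<^sup>2" unfolding power_mult_distrib by simp
    have "norm (exp ((s - 1) * hankel_log \<epsilon> t)) * exp (- Re (\<beta> * hankel \<epsilon> t)) *
      norm (hankel_deriv \<epsilon> t) * (1 + norm (hankel \<epsilon> t)) ^ r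
      \<le> (E1 * (1 + a) ^ p) * (E2 * exp (- Re \<beta> * a)) * (1 + \<epsilon>) * (1 + a) ^ r"
      unfolding a_def[symmetric]
      using 1 2 d a e pos by (intro mult_right_mono mult_mono) auto
    also have "\<dots> = E1 * E2 * (1 + \<epsilon>) * ((1 + a) ^ (p + r + 2) * exp (- Re \<beta> * a)) / (1 + a)\<^sup>2"
    proof -
      have "E1 * A * (E2 * X) * u * B = E1 * E2 * u * (A * B * q * X) / q"
        if "q \<noteq> 0" for A B X u q :: real
        using that by simp
      moreover have "(1 + a)\<^sup>2 \<noteq> 0" using a by simp
      ultimately show ?thesis unfolding power_add by blast
    qed
    also have "\<dots> \<le> E1 * E2 * (1 + \<epsilon>) * (D * exp (Re \<beta> * a) * exp (- Re \<beta> * a)) / (1 + a)\<^sup>2"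
      using D(2)[of a] a e pos by (intro divide_right_mono mult_left_mono mult_right_mono) auto
    also have "\<dots> = E1 * E2 * (1 + \<epsilon>) * D / (1 + a)\<^sup>2" by (simp add: mult.assoc flip: exp_add)
    also have "\<dots> = C / (65 * (1 + a)\<^sup>2)" by (simp add: C_def)
    also have "\<dots> \<le> C / (1 + t\<^sup>2)"
      using t2 pos a by (intro divide_left_mono mult_pos_pos) (auto simp: add_pos_nonneg)
    finally show ?thesis by (simp add: divide_inverse)
  qed
  then show ?thesis using that pos by blast
qed

lemma integrable_lborel_inverse_1_plus_square:
  "integrable lborel (\<lambda>t::real. inverse (1 + t\<^sup>2))"
  using integrable_inverse_1_plus_square by (simp add: set_integrable_def)

subsection \<open>Growth on the multiple contour\<close>

lemma Re_hankel_mult_ge: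
  assumes "\<epsilon> > 0" "x \<in> range (hankel \<epsilon>)" "Re c \<ge> 0"
  shows "Re (c * x) \<ge> - \<epsilon> * norm c"
  using assms(1,2)
proof (cases rule: hankel_cases)
  case 1
  have "\<bar>Re (c * x)\<bar> \<le> norm c * \<epsilon>"
    using abs_Re_le_cmod[of "c * x"] 1 by (simp add: norm_mult)
  then show ?thesis by (simp add: abs_le_iff mult.commute)
next
  case (2 a)
  then have "Re (c * x) \<ge> 0" "\<epsilon> * norm c \<ge> 0" using assms by simp_all
  then show ?thesis by linarith
qed

text \<open>On the rays, c x is a positive multiple of c, whose slope is at most \<open>M\<close>.
  On the circle |c x| = \<epsilon> |c|: one copy of this bounds the imaginary part, and
  \<open>M\<close> copies compensate a negative real part.\<close>

lemma Im_hankel_mult_le: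
  assumes "\<epsilon> > 0" "x \<in> range (hankel \<epsilon>)" "c = 0 \<or> Re c > 0" "norm c / Re c \<le> M"
  shows "\<bar>Im (c * x)\<bar> \<le> M * Re (c * x) + (M + 1) * \<epsilon> * norm c"
proof (cases "c = 0")
  case False
  then have c: "Re c > 0" using assms by simp
  then have M: "M \<ge> 0" using assms(4) order_trans[of 0 "norm c / Re c" M] by simp
  from assms(1,2) show ?thesis
  proof (cases rule: hankel_cases)
    case 1
    have "\<bar>Im (c * x)\<bar> \<le> \<epsilon> * norm c"
      using abs_Im_le_cmod[of "c * x"] 1 by (simp add: norm_mult mult.commute)
    moreover have "M * (- \<epsilon> * norm c) \<le> M * Re (c * x)"
      using Re_hankel_mult_ge[OF assms(1,2)] c M by (intro mult_left_mono) auto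
    ultimately show ?thesis by (simp add: algebra_simps)
  next
    case (2 a)
    have "\<bar>Im (c * x)\<bar> \<le> norm c * a"
      using abs_Im_le_cmod[of "c * x"] 2 assms(1) by (simp add: norm_mult)
    also have "\<dots> \<le> M * Re c * a"
      using assms(4) c 2 assms(1) by (intro mult_right_mono) (auto simp: field_simps)
    also have "\<dots> = M * Re (c * x)" using 2 by simp
    finally have "\<bar>Im (c * x)\<bar> \<le> M * Re (c * x)" .
    moreover have "(M + 1) * \<epsilon> * norm c \<ge> 0" using M assms(1) by simp
    ultimately show ?thesis by linarith
  qed
qed simp

lemma Re_hankel_sum_ge:
  assumes "\<epsilon> > 0" "\<And>j. x j \<in> range (hankel \<epsilon>)" "\<And>j. Re (c j) \<ge> 0"
  shows "Re (\<Sum>j\<in>UNIV. c j * x j) \<ge> - \<epsilon> * (\<Sum>j\<in>(UNIV::'d::finite set). norm (c j))"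
proof -
  have "- \<epsilon> * (\<Sum>j\<in>UNIV. norm (c j)) = (\<Sum>j\<in>(UNIV::'d set). - \<epsilon> * norm (c j))"
    by (simp only: sum_distrib_left)
  also have "\<dots> \<le> (\<Sum>j\<in>UNIV. Re (c j * x j))"
    by (intro sum_mono Re_hankel_mult_ge assms)
  finally show ?thesis by simp
qed

lemma Im_hankel_sum_le:
  assumes "\<epsilon> > 0" "\<And>j. x j \<in> range (hankel \<epsilon>)" "\<And>j. c j = 0 \<or> Re (c j) > 0"
    and "\<And>j. norm (c j) / Re (c j) \<le> M"
  shows "\<bar>Im (\<Sum>j\<in>UNIV. c j * x j)\<bar> \<le>
    M * Re (\<Sum>j\<in>UNIV. c j * x j) + (M + 1) * \<epsilon> * (\<Sum>j\<in>(UNIV::'d::finite set). norm (c j))"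
proof -
  have "\<bar>Im (\<Sum>j\<in>UNIV. c j * x j)\<bar> \<le> (\<Sum>j\<in>(UNIV::'d set). \<bar>Im (c j * x j)\<bar>)"
    unfolding Im_sum by (rule sum_abs)
  also have "\<dots> \<le> (\<Sum>j\<in>UNIV. M * Re (c j * x j) + (M + 1) * \<epsilon> * norm (c j))"
    by (intro sum_mono Im_hankel_mult_le assms)
  also have "\<dots> = M * Re (\<Sum>j\<in>UNIV. c j * x j) + (M + 1) * \<epsilon> * (\<Sum>j\<in>UNIV. norm (c j))"
    unfolding sum.distrib Re_sum sum_distrib_left ..
  finally show ?thesis .
qed

text \<open>
  If \<open>|\<xi>\<^sub>k| = 1\<close> and \<open>\<gamma>\<^sub>j\<^sub>k\<close> were a nonzero imaginary number, all other variables could be put on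
  the circle so that the whole argument is imaginary; moving \<open>x\<^sub>j\<close> along the ray would meet a pole.
\<close>

lemma hankel_avoids_poles_imp_Re_pos:
  fixes \<xi> :: "complex^'r" and \<gamma> :: "complex^'r^'d"
  assumes e: "\<epsilon> > 0" and av: "hankel_avoids_poles \<epsilon> \<xi> \<gamma>"
    and xi: "norm (\<xi> $ k) = 1" and gam: "Re (\<gamma> $ j $ k) \<ge> 0"
  shows "\<gamma> $ j $ k = 0 \<or> Re (\<gamma> $ j $ k) > 0"
proof (rule ccontr)
  assume "\<not> ?thesis"
  then have re: "Re (\<gamma> $ j $ k) = 0" and nz: "\<gamma> $ j $ k \<noteq> 0" using gam by auto
  define c where "c = Im (\<gamma> $ j $ k)"
  have gc: "\<gamma> $ j $ k = \<i> * of_real c" using re by (simp add: c_def complex_eq_iff)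
  then have c: "c \<noteq> 0" using nz by auto
  \<comment> \<open>\<open>u i\<close> is the point of the unit circle that rotates
    \<open>\<gamma> $ i $ k\<close> onto the positive imaginary axis, so the circle points
    \<open>\<epsilon> * u i\<close> with i different from j contribute \<open>\<i> * R\<close> in
    total.\<close>
  define u where "u i = (if \<gamma> $ i $ k = 0 then 1 else \<i> * cnj (\<gamma> $ i $ k) / of_real (norm (\<gamma> $ i $ k)))" for i
  have nu: "norm (u i) = 1" for i by (simp add: u_def norm_mult norm_divide)
  have gu: "\<gamma> $ i $ k * u i = \<i> * of_real (norm (\<gamma> $ i $ k))" for i
    by (simp add: u_def divide_simps power2_eq_square flip: complex_norm_square)
  define R where "R = \<epsilon> * (\<Sum>i\<in>UNIV-{j}. norm (\<gamma> $ i $ k))"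
  define \<theta> where "\<theta> = Arg (\<xi> $ k)"
  have \<theta>: "\<xi> $ k = exp (\<i> * of_real \<theta>)"
  proof -
    have "\<xi> $ k \<noteq> 0" using xi by auto
    from Arg_eq[OF this] xi show ?thesis by (simp add: \<theta>_def)
  qed
  \<comment> \<open>Large enough for two purposes: \<open>a > \<epsilon>\<close>, so that
    \<open>a\<close> lies on the ray, and a nonzero argument, so that the singularity met is not the
    exempted point 0.\<close>
  obtain N :: nat where N: "real N > \<bar>\<theta>\<bar> + \<bar>R\<bar> + \<epsilon> * \<bar>c\<bar>"
    using reals_Archimedean2 by blast
  \<comment> \<open>The sign makes 2 pi n / c positive. The number \<open>a\<close> solves c a + R =
    \<theta> + 2 pi n, which turns the argument of F into a logarithm of
    \<open>\<xi> $ k\<close>.\<close>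
  define n where "n = sgn c * real N"
  define a where "a = (\<theta> + 2 * pi * n - R) / c"
  have "2 * pi * real N \<ge> 1 * real N" using pi_gt3 by (intro mult_right_mono) auto
  then have N': "2 * pi * real N > \<bar>\<theta>\<bar> + \<bar>R\<bar> + \<epsilon> * \<bar>c\<bar>" using N by linarith
  have "a * \<bar>c\<bar> > \<epsilon> * \<bar>c\<bar>"
  proof -
    have "a * \<bar>c\<bar> = (\<theta> - R) * sgn c + 2 * pi * real N"
      using c by (auto simp: a_def n_def sgn_if abs_if field_simps)
    moreover have "\<bar>(\<theta> - R) * sgn c\<bar> \<le> \<bar>\<theta>\<bar> + \<bar>R\<bar>" using c by (auto simp: abs_mult sgn_if)
    ultimately show ?thesis using N' by linarith
  qed
  then have a: "a > \<epsilon>" by (rule mult_right_less_imp_less) simp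
  define x where "x i = (if i = j then of_real a else of_real \<epsilon> * u i)" for i
  have xr: "x i \<in> range (hankel \<epsilon>)" for i
    using real_in_range_hankel[OF e a] circle_in_range_hankel[OF e, of "of_real \<epsilon> * u i"] nu e
    by (simp add: x_def norm_mult)
  have "(\<Sum>i\<in>UNIV. \<gamma> $ i $ k * x i) =
      \<gamma> $ j $ k * x j + (\<Sum>i\<in>UNIV-{j}. of_real \<epsilon> * (\<gamma> $ i $ k * u i))"
    by (subst sum.remove[of _ j]) (auto intro!: sum.cong simp: x_def mult_ac)
  also have "\<dots> = \<i> * of_real (c * a + R)"
    unfolding gu gc x_def R_def by (simp add: sum_distrib_left algebra_simps)
  also have "c * a + R = \<theta> + 2 * pi * n" using c by (simp add: a_def)
  finally have y: "(\<Sum>i\<in>UNIV. \<gamma> $ i $ k * x i) = \<i> * of_real (\<theta> + 2 * pi * n)" .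
  have "exp (\<i> * of_real (\<theta> + 2 * pi * n)) = \<xi> $ k"
  proof -
    define m :: int where "m = (if c > 0 then int N else - int N)"
    have "n = of_int m" using c by (auto simp: n_def m_def sgn_if)
    then have "\<i> * of_real (\<theta> + 2 * pi * n) = \<i> * of_real \<theta> + of_int (2 * m) * (of_real pi * \<i>)"
      by (simp add: algebra_simps)
    then show ?thesis unfolding \<theta> by (auto simp: exp_eq)
  qed
  then have "\<theta> + 2 * pi * n = 0"
    using av xr y unfolding hankel_avoids_poles_def
    by (metis (no_types, lifting) complex_i_not_zero mult_eq_0_iff of_real_eq_0_iff)
  moreover have "\<bar>2 * pi * n\<bar> = 2 * pi * real N" using c by (auto simp: n_def sgn_if)
  moreover have "\<epsilon> * \<bar>c\<bar> \<ge> 0" using e by simp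
  ultimately show False using N' by linarith
qed

text \<open>A property of a single \<epsilon>, so that the integral can be studied for fixed
  \<epsilon>; the constants may depend on \<epsilon> but not on the point of the contour.\<close>

definition des_F_contour_bounded :: "real \<Rightarrow> complex^'r \<Rightarrow> complex^'r^'d \<Rightarrow> bool" where
  "des_F_contour_bounded \<epsilon> \<xi> \<gamma> \<longleftrightarrow>
     (\<forall>k. \<exists>C>0. \<forall>x. (\<forall>j. x j \<in> range (hankel \<epsilon>)) \<longrightarrow>
        norm (des_F (des_delta (\<xi> $ k)) (\<xi> $ k) (\<Sum>j\<in>UNIV. \<gamma> $ j $ k * x j)) \<le>
          C * (1 + norm (\<Sum>j\<in>UNIV. \<gamma> $ j $ k * x j)) * exp (- Re (\<Sum>j\<in>UNIV. \<gamma> $ j $ k * x j)))"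

text \<open>The circle is the only source of a negative real part or of an excess over the cone, and
  both are O(\<epsilon>). So eventually |\<xi>_k| < exp (- \<epsilon> G) if |\<xi>_k| < 1, and (M +
  1) \<epsilon> G < \<rho> if |\<xi>_k| = 1, as the two bounds for F require.\<close>

lemma eventually_des_F_contour_bounded:
  fixes \<xi> :: "complex^'r" and \<gamma> :: "complex^'r^'d"
  assumes xi: "\<And>k. norm (\<xi> $ k) \<le> 1"
    and gam: "\<And>j k. Re (\<gamma> $ j $ k) \<ge> 0"
    and gam': "\<And>j k. norm (\<xi> $ k) = 1 \<Longrightarrow> \<gamma> $ j $ k = 0 \<or> Re (\<gamma> $ j $ k) > 0"
  shows "\<forall>\<^sub>F \<epsilon> in at_right 0. des_F_contour_bounded \<epsilon> \<xi> \<gamma>"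
  unfolding des_F_contour_bounded_def
proof (rule eventually_all_finite)
  fix k
  define G where "G = (\<Sum>j\<in>UNIV. norm (\<gamma> $ j $ k))"
  have pos: "\<forall>\<^sub>F \<epsilon> in at_right 0. \<epsilon> > (0::real)" by (simp add: eventually_at_right_less)
  show "\<forall>\<^sub>F \<epsilon> in at_right 0. \<exists>C>0. \<forall>x. (\<forall>j. x j \<in> range (hankel \<epsilon>)) \<longrightarrow>
    norm (des_F (des_delta (\<xi> $ k)) (\<xi> $ k) (\<Sum>j\<in>UNIV. \<gamma> $ j $ k * x j)) \<le>
      C * (1 + norm (\<Sum>j\<in>UNIV. \<gamma> $ j $ k * x j)) * exp (- Re (\<Sum>j\<in>UNIV. \<gamma> $ j $ k * x j))"
  proof (cases "norm (\<xi> $ k) = 1")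
    case False
    then have lt: "norm (\<xi> $ k) < 1" using xi[of k] by linarith
    have "((\<lambda>\<epsilon>. exp (- \<epsilon> * G)) \<longlongrightarrow> exp (- 0 * G)) (at_right 0)"
      by (intro tendsto_intros)
    then have "\<forall>\<^sub>F \<epsilon> in at_right 0. norm (\<xi> $ k) < exp (- \<epsilon> * G)"
      using lt by (intro order_tendstoD(1)) auto
    with pos show ?thesis
    proof eventually_elim
      case (elim \<epsilon>)
      obtain C where C: "C > 0" "\<And>y. Re y \<ge> - \<epsilon> * G \<Longrightarrow>
          norm (des_F (des_delta (\<xi> $ k)) (\<xi> $ k) y) \<le> C * (1 + norm y) * exp (- Re y)"
        using des_F_bound_inside[OF lt elim(2)] by blast
      then show ?case using Re_hankel_sum_ge[OF elim(1), of _ "\<lambda>j. \<gamma> $ j $ k"] gam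
        by (auto simp: G_def intro!: exI[of _ C] simp del: Re_sum)
    qed
  next
    case True
    \<comment> \<open>The summands are nonnegative, so each quotient is at most the sum. For
      \<open>\<gamma> $ j $ k = 0\<close> the quotient is 0 by the convention for division.\<close>
    define M where "M = (\<Sum>j\<in>UNIV. norm (\<gamma> $ j $ k) / Re (\<gamma> $ j $ k))"
    have M: "norm (\<gamma> $ j $ k) / Re (\<gamma> $ j $ k) \<le> M" for j
      unfolding M_def using gam
      by (intro member_le_sum[of j UNIV "\<lambda>j. norm (\<gamma> $ j $ k) / Re (\<gamma> $ j $ k)"]) auto
    obtain \<rho> where \<rho>: "\<rho> > 0" "\<And>y. norm y < \<rho> \<Longrightarrow> exp y = \<xi> $ k \<Longrightarrow> y = 0"
      using exp_eq_isolated_at_0[of "\<xi> $ k"] by blast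
    have "((\<lambda>\<epsilon>. (M + 1) * \<epsilon> * G) \<longlongrightarrow> (M + 1) * 0 * G) (at_right 0)"
      by (intro tendsto_intros)
    then have "\<forall>\<^sub>F \<epsilon> in at_right 0. (M + 1) * \<epsilon> * G < \<rho>"
      using \<rho> by (intro order_tendstoD(2)) auto
    with pos show ?thesis
    proof eventually_elim
      case (elim \<epsilon>)
      obtain C where C: "C > 0" "\<And>y. Re y \<ge> - \<epsilon> * G \<Longrightarrow> \<bar>Im y\<bar> \<le> M * Re y + (M + 1) * \<epsilon> * G \<Longrightarrow>
          norm (des_F (des_delta (\<xi> $ k)) (\<xi> $ k) y) \<le> C * (1 + norm y) * exp (- Re y)"
        using des_F_bound_cone[OF True \<rho>(2) elim(2), of "- \<epsilon> * G" M] by blast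
      show ?case
      proof (intro exI[of _ C] conjI allI impI C)
        fix x :: "'d \<Rightarrow> complex" assume x: "\<forall>j. x j \<in> range (hankel \<epsilon>)"
        show "- \<epsilon> * G \<le> Re (\<Sum>j\<in>UNIV. \<gamma> $ j $ k * x j)"
          unfolding G_def by (rule Re_hankel_sum_ge) (use elim x gam in auto)
        show "\<bar>Im (\<Sum>j\<in>UNIV. \<gamma> $ j $ k * x j)\<bar> \<le>
            M * Re (\<Sum>j\<in>UNIV. \<gamma> $ j $ k * x j) + (M + 1) * \<epsilon> * G"
          unfolding G_def by (rule Im_hankel_sum_le) (use elim x gam'[OF True] M in auto)
      qed
    qed
  qed
qed

subsection \<open>The contour integral as a function of s\<close>

definition hankel_integrand ::
  "real \<Rightarrow> complex^'r \<Rightarrow> complex^'r^'d \<Rightarrow> complex^'d \<Rightarrow> complex^'d \<Rightarrow> ('d \<Rightarrow> real) \<Rightarrow> complex" where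
  "hankel_integrand \<epsilon> \<xi> \<gamma> \<beta> s t =
     (\<Prod>j\<in>UNIV. exp ((s $ j - 1) * hankel_log \<epsilon> (t j))
              * exp (((\<Sum>k\<in>UNIV. \<gamma> $ j $ k) - \<beta> $ j) * hankel \<epsilon> (t j))
              * hankel_deriv \<epsilon> (t j))
     * (\<Prod>k\<in>UNIV. des_F (des_delta (\<xi> $ k)) (\<xi> $ k) (\<Sum>j\<in>UNIV. \<gamma> $ j $ k * hankel \<epsilon> (t j)))"

lemma hankel_integral_eq:
  "hankel_integral \<epsilon> \<xi> \<gamma> \<beta> s = (LINT t | PiM UNIV (\<lambda>_. lborel). hankel_integrand \<epsilon> \<xi> \<gamma> \<beta> s t)"
  by (simp add: hankel_integral_def hankel_integrand_def)

text \<open>\<open>des_F\<close> is given by \<open>remove_sings\<close>, whose measurability cannot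
  be read off. On the contour exp y = \<xi>_k only at y = 0, so F equals a case distinction between
  one constant and an explicit formula.\<close>

lemma hankel_integrand_measurable:
  fixes \<xi> :: "complex^'r" and \<gamma> :: "complex^'r^'d"
  assumes "hankel_avoids_poles \<epsilon> \<xi> \<gamma>"
  shows "hankel_integrand \<epsilon> \<xi> \<gamma> \<beta> s \<in> borel_measurable (PiM UNIV (\<lambda>_. lborel))"
proof -
  have gen: "des_F (des_delta c) c y = (if exp y = c then des_F (des_delta c) c 0
       else 1 / (exp y - c) - of_nat (des_delta c) * (y * exp y / (exp y - 1)\<^sup>2))"
    if "exp y = c \<Longrightarrow> y = 0" for c y
    using that des_F_eq[of y c] by (cases "exp y = c") simp_all
  have F: "des_F (des_delta (\<xi> $ k)) (\<xi> $ k) (\<Sum>j\<in>UNIV. \<gamma> $ j $ k * hankel \<epsilon> (t j)) =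
      (let y = \<Sum>j\<in>UNIV. \<gamma> $ j $ k * hankel \<epsilon> (t j) in
       if exp y = \<xi> $ k then des_F (des_delta (\<xi> $ k)) (\<xi> $ k) 0
       else 1 / (exp y - \<xi> $ k) - of_nat (des_delta (\<xi> $ k)) * (y * exp y / (exp y - 1)\<^sup>2))"
    for k and t :: "'d \<Rightarrow> real"
  proof -
    have "exp (\<Sum>j\<in>UNIV. \<gamma> $ j $ k * hankel \<epsilon> (t j)) = \<xi> $ k \<Longrightarrow>
      (\<Sum>j\<in>UNIV. \<gamma> $ j $ k * hankel \<epsilon> (t j)) = 0"
      using assms[unfolded hankel_avoids_poles_def, rule_format, of "\<lambda>j. hankel \<epsilon> (t j)" k] by blast
    then show ?thesis unfolding Let_def by (rule gen)
  qed
  show ?thesis unfolding hankel_integrand_def F Let_def by measurable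
qed

text \<open>Separates the variables: the growth of F in the sum is bounded by a product of
  one-variable factors, to which integrability of products applies.\<close>

lemma one_plus_norm_sum_le:
  fixes c x :: "'d::finite \<Rightarrow> complex"
  shows "1 + norm (\<Sum>j\<in>UNIV. c j * x j) \<le>
    (1 + (\<Sum>j\<in>UNIV. norm (c j))) * (\<Prod>j\<in>UNIV. 1 + norm (x j))"
proof -
  let ?P = "\<Prod>j\<in>UNIV. 1 + norm (x j)"
  have P1: "1 \<le> ?P" by (intro prod_ge_1) auto
  have xP: "norm (x j) \<le> ?P" for j
  proof -
    have "norm (x j) \<le> (1 + norm (x j)) * 1" by simp
    also have "\<dots> \<le> (1 + norm (x j)) * (\<Prod>i\<in>UNIV-{j}. 1 + norm (x i))"
      by (intro mult_left_mono prod_ge_1) auto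
    also have "\<dots> = ?P" by (subst prod.remove[of UNIV j]) auto
    finally show ?thesis .
  qed
  have "norm (\<Sum>j\<in>UNIV. c j * x j) \<le> (\<Sum>j\<in>UNIV. norm (c j) * ?P)"
    by (intro sum_norm_le) (auto simp: norm_mult intro!: mult_left_mono xP)
  then show ?thesis using P1 by (simp add: distrib_right sum_distrib_right)
qed

text \<open>Each of the \<open>CARD('r)\<close> functions F contributes one factor 1 + |x_j| in
  every variable, whence the power in the one-variable estimate. The constant is uniform over a
  polydisc in s, as dominated convergence needs.\<close>

lemma hankel_integrand_bound:
  fixes \<xi> :: "complex^'r" and \<gamma> :: "complex^'r^'d" and \<beta> :: "complex^'d" and p :: nat
  assumes e: "\<epsilon> > 0" and b: "\<And>j. Re (\<beta> $ j) > 0"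
    and F: "des_F_contour_bounded \<epsilon> \<xi> \<gamma>"
  obtains C where "C > 0"
    "\<And>s t. (\<And>j. norm (s $ j - 1) \<le> of_nat p) \<Longrightarrow>
      norm (hankel_integrand \<epsilon> \<xi> \<gamma> \<beta> s t) \<le> C * (\<Prod>j\<in>UNIV. inverse (1 + (t j)\<^sup>2))"
proof -
  obtain A where A: "\<And>k. A k > 0" "\<And>k x. (\<forall>j. x j \<in> range (hankel \<epsilon>)) \<Longrightarrow>
      norm (des_F (des_delta (\<xi> $ k)) (\<xi> $ k) (\<Sum>j\<in>UNIV. \<gamma> $ j $ k * x j)) \<le>
        A k * (1 + norm (\<Sum>j\<in>UNIV. \<gamma> $ j $ k * x j)) * exp (- Re (\<Sum>j\<in>UNIV. \<gamma> $ j $ k * x j))"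
    using choice[OF F[unfolded des_F_contour_bounded_def]] by blast
  have "\<forall>j. \<exists>C>0. \<forall>s t. norm (s - 1) \<le> of_nat p \<longrightarrow>
      norm (exp ((s - 1) * hankel_log \<epsilon> t)) * exp (- Re (\<beta> $ j * hankel \<epsilon> t)) *
      norm (hankel_deriv \<epsilon> t) * (1 + norm (hankel \<epsilon> t)) ^ CARD('r) \<le> C * inverse (1 + t\<^sup>2)"
  proof
    fix j
    show "\<exists>C>0. \<forall>s t. norm (s - 1) \<le> of_nat p \<longrightarrow>
      norm (exp ((s - 1) * hankel_log \<epsilon> t)) * exp (- Re (\<beta> $ j * hankel \<epsilon> t)) *
      norm (hankel_deriv \<epsilon> t) * (1 + norm (hankel \<epsilon> t)) ^ CARD('r) \<le> C * inverse (1 + t\<^sup>2)"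
      by (rule hankel_factor_bound[OF e b[of j], where p = p and r = "CARD('r)"]) blast
  qed
  from choice[OF this] obtain B where B: "\<And>j. B j > 0" "\<And>j s t. norm (s - 1) \<le> of_nat p \<Longrightarrow>
      norm (exp ((s - 1) * hankel_log \<epsilon> t)) * exp (- Re (\<beta> $ j * hankel \<epsilon> t)) *
      norm (hankel_deriv \<epsilon> t) * (1 + norm (hankel \<epsilon> t)) ^ CARD('r) \<le> B j * inverse (1 + t\<^sup>2)"
    by blast
  define G where "G k = (\<Sum>j\<in>UNIV. norm (\<gamma> $ j $ k))" for k
  have G: "G k \<ge> 0" for k by (simp add: G_def sum_nonneg)
  define E where "E = (\<Prod>k\<in>UNIV. A k * (1 + G k))"
  have E: "E > 0" unfolding E_def using A G
    by (intro prod_pos) (simp add: add_pos_nonneg)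
  define C where "C = (\<Prod>j\<in>UNIV. B j) * E"
  have "norm (hankel_integrand \<epsilon> \<xi> \<gamma> \<beta> s t) \<le> C * (\<Prod>j\<in>UNIV. inverse (1 + (t j)\<^sup>2))"
    if s: "\<And>j. norm (s $ j - 1) \<le> of_nat p" for s t
  proof -
    define x where "x j = hankel \<epsilon> (t j)" for j
    define y where "y k = (\<Sum>j\<in>UNIV. \<gamma> $ j $ k * x j)" for k
    define P where "P = (\<Prod>j\<in>UNIV. 1 + norm (x j))"
    have xr: "\<forall>j. x j \<in> range (hankel \<epsilon>)" by (simp add: x_def)
    have "norm (des_F (des_delta (\<xi> $ k)) (\<xi> $ k) (y k)) \<le> A k * (1 + G k) * P * exp (- Re (y k))" for k
    proof -
      have "norm (des_F (des_delta (\<xi> $ k)) (\<xi> $ k) (y k)) \<le> A k * (1 + norm (y k)) * exp (- Re (y k))"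
        unfolding y_def using A(2)[OF xr] .
      also have "1 + norm (y k) \<le> (1 + G k) * P"
        unfolding y_def G_def P_def by (rule one_plus_norm_sum_le)
      finally show ?thesis using A(1)[of k] by (simp add: mult.assoc)
    qed
    then have "(\<Prod>k\<in>UNIV. norm (des_F (des_delta (\<xi> $ k)) (\<xi> $ k) (y k))) \<le>
        (\<Prod>k\<in>UNIV. A k * (1 + G k) * P * exp (- Re (y k)))"
      by (intro prod_mono) auto
    also have "\<dots> = E * P ^ CARD('r) * (\<Prod>k\<in>UNIV. exp (- Re (y k)))"
      by (simp add: prod.distrib E_def)
    also have "(\<Prod>k\<in>UNIV. exp (- Re (y k))) = exp (\<Sum>k\<in>UNIV. - Re (y k))"
      by (simp add: exp_sum)
    \<comment> \<open>Exchanging the sums regroups the decay of the functions F by the variables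
      x_j, so that it meets the matching exponentials in the first product.\<close>
    also have "(\<Sum>k\<in>UNIV. - Re (y k)) = (\<Sum>j\<in>UNIV. - Re ((\<Sum>k\<in>UNIV. \<gamma> $ j $ k) * x j))"
      unfolding y_def Re_sum sum_distrib_right sum_negf by (subst sum.swap) rule
    also have "exp \<dots> = (\<Prod>j\<in>UNIV. exp (- Re ((\<Sum>k\<in>UNIV. \<gamma> $ j $ k) * x j)))"
      by (simp add: exp_sum)
    also have "E * P ^ CARD('r) * \<dots> =
        E * (\<Prod>j\<in>UNIV. (1 + norm (x j)) ^ CARD('r) * exp (- Re ((\<Sum>k\<in>UNIV. \<gamma> $ j $ k) * x j)))"
      by (simp add: P_def prod.distrib prod_power_distrib)
    finally have 1: "(\<Prod>k\<in>UNIV. norm (des_F (des_delta (\<xi> $ k)) (\<xi> $ k) (y k))) \<le> \<dots>" .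
    have "norm (hankel_integrand \<epsilon> \<xi> \<gamma> \<beta> s t) =
      (\<Prod>j\<in>UNIV. norm (exp ((s $ j - 1) * hankel_log \<epsilon> (t j))) *
        exp (Re (((\<Sum>k\<in>UNIV. \<gamma> $ j $ k) - \<beta> $ j) * x j)) * norm (hankel_deriv \<epsilon> (t j))) *
      (\<Prod>k\<in>UNIV. norm (des_F (des_delta (\<xi> $ k)) (\<xi> $ k) (y k)))"
      unfolding hankel_integrand_def x_def[symmetric] y_def[symmetric] norm_mult
      by (simp only: norm_mult prod_norm norm_exp_eq_Re flip: prod_norm)
    also have "\<dots> \<le>
      (\<Prod>j\<in>UNIV. norm (exp ((s $ j - 1) * hankel_log \<epsilon> (t j))) *
        exp (Re (((\<Sum>k\<in>UNIV. \<gamma> $ j $ k) - \<beta> $ j) * x j)) * norm (hankel_deriv \<epsilon> (t j))) *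
      (E * (\<Prod>j\<in>UNIV. (1 + norm (x j)) ^ CARD('r) * exp (- Re ((\<Sum>k\<in>UNIV. \<gamma> $ j $ k) * x j))))"
      using 1 by (intro mult_left_mono prod_nonneg) auto
    also have "\<dots> = E * (\<Prod>j\<in>UNIV. norm (exp ((s $ j - 1) * hankel_log \<epsilon> (t j))) *
        (exp (Re (((\<Sum>k\<in>UNIV. \<gamma> $ j $ k) - \<beta> $ j) * x j)) * exp (- Re ((\<Sum>k\<in>UNIV. \<gamma> $ j $ k) * x j)))
        * norm (hankel_deriv \<epsilon> (t j)) * (1 + norm (x j)) ^ CARD('r))"
      by (simp only: prod.distrib mult_ac)
    also have "\<dots> = E * (\<Prod>j\<in>UNIV. norm (exp ((s $ j - 1) * hankel_log \<epsilon> (t j))) *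
        exp (- Re (\<beta> $ j * x j)) * norm (hankel_deriv \<epsilon> (t j)) * (1 + norm (x j)) ^ CARD('r))"
    proof -
      have "exp (Re ((g - b) * z)) * exp (- Re (g * z)) = exp (- Re (b * z))" for g b z
        by (simp add: left_diff_distrib flip: exp_add)
      then show ?thesis by (simp only:)
    qed
    also have "\<dots> \<le> E * (\<Prod>j\<in>UNIV. B j * inverse (1 + (t j)\<^sup>2))"
      unfolding x_def using E B(2)[OF s] by (intro mult_left_mono prod_mono) auto
    finally show ?thesis by (simp add: C_def prod.distrib mult_ac)
  qed
  moreover have "C > 0" unfolding C_def using E B by (intro mult_pos_pos prod_pos) auto
  ultimately show ?thesis using that by blast
qed

lemma integrable_prod_inverse_1_plus_square:
  "integrable (PiM (UNIV::'d::finite set) (\<lambda>_. lborel)) (\<lambda>t. C * (\<Prod>j\<in>UNIV. inverse (1 + (t j)\<^sup>2)) :: real)"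
proof -
  interpret product_sigma_finite "\<lambda>_::'d. lborel::real measure" by standard
  show ?thesis
    by (intro integrable_mult_right product_integrable_prod integrable_lborel_inverse_1_plus_square) auto
qed

lemma hankel_integrand_integrable:
  fixes \<xi> :: "complex^'r" and \<gamma> :: "complex^'r^'d" and \<beta> :: "complex^'d"
  assumes e: "\<epsilon> > 0" and b: "\<And>j. Re (\<beta> $ j) > 0" and av: "hankel_avoids_poles \<epsilon> \<xi> \<gamma>"
    and F: "des_F_contour_bounded \<epsilon> \<xi> \<gamma>"
  shows "integrable (PiM UNIV (\<lambda>_. lborel)) (hankel_integrand \<epsilon> \<xi> \<gamma> \<beta> s)"
proof -
  obtain p :: nat where p: "norm s + 1 \<le> of_nat p" using real_arch_simple by blast
  have ps: "norm (s $ j - 1) \<le> of_nat p" for j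
    using norm_triangle_ineq4[of "s $ j" 1] Finite_Cartesian_Product.norm_nth_le[of s j] p by simp
  obtain C where C: "C > 0" "\<And>s t. (\<And>j. norm (s $ j - 1) \<le> of_nat p) \<Longrightarrow>
      norm (hankel_integrand \<epsilon> \<xi> \<gamma> \<beta> s t) \<le> C * (\<Prod>j\<in>UNIV. inverse (1 + (t j)\<^sup>2))"
    using hankel_integrand_bound[OF e b F, where p = p] by blast
  show ?thesis
  proof (rule Bochner_Integration.integrable_bound[OF integrable_prod_inverse_1_plus_square[of C]])
    show "AE t in PiM UNIV (\<lambda>_. lborel). norm (hankel_integrand \<epsilon> \<xi> \<gamma> \<beta> s t) \<le>
        norm (C * (\<Prod>j\<in>UNIV. inverse (1 + (t j)\<^sup>2)))"
      using C(2)[OF ps] by (intro AE_I2) (metis abs_ge_self order_trans real_norm_def)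
  qed (rule hankel_integrand_measurable[OF av])
qed

text \<open>A convergent sequence of parameters is bounded, so a single \<open>p\<close>, and with
  it a single majorant, serves all its terms.\<close>

lemma hankel_integral_continuous:
  fixes \<xi> :: "complex^'r" and \<gamma> :: "complex^'r^'d" and \<beta> :: "complex^'d"
  assumes e: "\<epsilon> > 0" and b: "\<And>j. Re (\<beta> $ j) > 0" and av: "hankel_avoids_poles \<epsilon> \<xi> \<gamma>"
    and F: "des_F_contour_bounded \<epsilon> \<xi> \<gamma>"
  shows "(hankel_integral \<epsilon> \<xi> \<gamma> \<beta> \<longlongrightarrow> hankel_integral \<epsilon> \<xi> \<gamma> \<beta> s) (at s within S)"
  unfolding tendsto_at_iff_sequentially
proof (intro allI impI)
  fix X assume X: "X \<longlonglongrightarrow> s"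
  then have "Bseq X" by (intro convergent_imp_Bseq) (auto simp: convergent_def)
  then obtain K where K: "\<And>i. norm (X i) \<le> K" by (auto simp: Bseq_def)
  obtain p :: nat where p: "K + 1 \<le> of_nat p" using real_arch_simple by blast
  have ps: "norm (X i $ j - 1) \<le> of_nat p" for i j
    using norm_triangle_ineq4[of "X i $ j" 1] Finite_Cartesian_Product.norm_nth_le[of "X i" j] K[of i] p by simp
  obtain C where C: "C > 0" "\<And>s t. (\<And>j. norm (s $ j - 1) \<le> of_nat p) \<Longrightarrow>
      norm (hankel_integrand \<epsilon> \<xi> \<gamma> \<beta> s t) \<le> C * (\<Prod>j\<in>UNIV. inverse (1 + (t j)\<^sup>2))"
    using hankel_integrand_bound[OF e b F, where p = p] by blast
  show "(hankel_integral \<epsilon> \<xi> \<gamma> \<beta> \<circ> X) \<longlonglongrightarrow> hankel_integral \<epsilon> \<xi> \<gamma> \<beta> s"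
    unfolding o_def hankel_integral_eq
  proof (rule integral_dominated_convergence)
    show "integrable (PiM (UNIV::'d set) (\<lambda>_. lborel)) (\<lambda>t. C * (\<Prod>j\<in>UNIV. inverse (1 + (t j)\<^sup>2)))"
      by (rule integrable_prod_inverse_1_plus_square)
    show "AE t in PiM UNIV (\<lambda>_. lborel).
        (\<lambda>i. hankel_integrand \<epsilon> \<xi> \<gamma> \<beta> (X i) t) \<longlonglongrightarrow> hankel_integrand \<epsilon> \<xi> \<gamma> \<beta> s t"
      unfolding hankel_integrand_def by (intro AE_I2 tendsto_intros X)
    show "AE t in PiM UNIV (\<lambda>_. lborel). norm (hankel_integrand \<epsilon> \<xi> \<gamma> \<beta> (X i) t) \<le>
        C * (\<Prod>j\<in>UNIV. inverse (1 + (t j)\<^sup>2))" for i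
      using C(2)[OF ps] by (intro AE_I2)
  qed (rule hankel_integrand_measurable[OF av])+
qed

section \<open>The prefactor and the limit at nonpositive integers\<close>

text \<open>The simple zero of exp (2 pi i z) - 1, with derivative 2 pi i, cancels the simple pole
  of \<open>Gamma\<close>, with residue (-1)^n / n!.\<close>

lemma prefactor_tendsto:
  "((\<lambda>z. (exp (2 * of_real pi * \<i> * z) - 1) * Gamma z) \<longlongrightarrow> 2 * of_real pi * \<i> * ((-1) ^ n / fact n))
     (at (- of_nat n :: complex))"
proof -
  define E where "E z = exp (2 * of_real pi * \<i> * z) - 1" for z :: complex
  have "exp (2 * of_real pi * \<i> * (- of_nat n)) = exp (of_int (2 * (- int n)) * (of_real pi * \<i>))"
    by (simp add: mult_ac)
  also have "\<dots> = 1" by (subst exp_eq_1) (auto intro!: exI[of _ "- int n"])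
  finally have e1: "exp (2 * of_real pi * \<i> * (- of_nat n)) = 1" .
  have "(E has_field_derivative 2 * of_real pi * \<i>) (at (- of_nat n))"
    unfolding E_def[abs_def] by (rule derivative_eq_intros refl)+ (simp only: e1 mult_1 mult_1_right diff_zero mult_zero_left add_0)
  then have "((\<lambda>z. (E z - E (- of_nat n)) / (z - (- of_nat n))) \<longlongrightarrow> 2 * of_real pi * \<i>) (at (- of_nat n))"
    by (simp add: has_field_derivative_iff)
  moreover have "E (- of_nat n) = 0" unfolding E_def e1 by simp
  ultimately have "((\<lambda>z. E z / (z + of_nat n)) \<longlongrightarrow> 2 * of_real pi * \<i>) (at (- of_nat n))" by simp
  from tendsto_mult[OF this Gamma_residues[of n]]
  have "((\<lambda>z. E z / (z + of_nat n) * (Gamma z * (z + of_nat n))) \<longlongrightarrow>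
      2 * of_real pi * \<i> * ((-1) ^ n / fact n)) (at (- of_nat n))" .
  moreover have "\<forall>\<^sub>F z in at (- of_nat n). E z / (z + of_nat n) * (Gamma z * (z + of_nat n)) = E z * Gamma z"
    unfolding eventually_at_filter by (intro always_eventually) (auto simp: add_eq_0_iff)
  ultimately show ?thesis unfolding E_def by (rule Lim_transform_eventually)
qed

lemma zeta_des_at_neg_int:
  fixes \<xi> :: "complex^'r" and \<gamma> :: "complex^'r^'d" and \<beta> :: "complex^'d" and l :: "'d \<Rightarrow> nat"
  assumes e: "\<epsilon> > 0" and b: "\<And>j. Re (\<beta> $ j) > 0" and av: "hankel_avoids_poles \<epsilon> \<xi> \<gamma>"
    and F: "des_F_contour_bounded \<epsilon> \<xi> \<gamma>"
  shows "zeta_des \<epsilon> \<xi> \<gamma> \<beta> (\<chi> j. - of_nat (l j)) =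
    (\<Prod>j\<in>UNIV. (-1) ^ l j * fact (l j)) / (2 * of_real pi * \<i>) ^ CARD('d) *
    hankel_integral \<epsilon> \<xi> \<gamma> \<beta> (\<chi> j. - of_nat (l j))"
proof -
  let ?s = "(\<chi> j. - of_nat (l j)) :: complex^'d"
  let ?A = "{z::complex^'d. \<forall>j. z $ j \<notin> \<int>}"
  \<comment> \<open>\<open>Lim\<close> is determined by convergence only along a nontrivial filter,
    so \<open>?s\<close> must be a limit point of the points with non-integral coordinates.\<close>
  have nt: "at ?s within ?A \<noteq> bot"
  proof -
    \<comment> \<open>The shift by 2 keeps every offset strictly between 0 and 1, also for n =
      0.\<close>
    define X where "X n = ((\<chi> j. - of_nat (l j) + 1 / (of_nat n + 2)) :: complex^'d)" for n :: nat
    have "X \<longlonglongrightarrow> ?s"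
    proof (rule vec_tendstoI)
      fix j
      have "(\<lambda>n. - of_nat (l j) + 1 / (of_nat (n + 2)) :: complex) \<longlonglongrightarrow> - of_nat (l j) + 0"
        by (intro tendsto_intros LIMSEQ_ignore_initial_segment[OF lim_1_over_n])
      then show "(\<lambda>n. X n $ j) \<longlonglongrightarrow> ?s $ j" by (simp add: X_def add.commute)
    qed
    moreover have nint: "X n $ j \<notin> \<int>" for n j
    proof
      assume "X n $ j \<in> \<int>"
      then have "X n $ j + of_nat (l j) \<in> \<int>" by (intro Ints_add) auto
      then have "1 / (of_nat n + 2) \<in> (\<int>::complex set)" by (simp add: X_def)
      then obtain m where "1 / (of_nat n + 2) = (of_int m :: complex)" by (auto elim: Ints_cases)
      then have "complex_of_real (1 / (real n + 2)) = of_real (of_int m)" by simp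
      then have m: "1 / (real n + 2) = of_int m" by (simp only: of_real_eq_iff)
      have "0 < 1 / (real n + 2)" "1 / (real n + 2) < 1" by auto
      then have "0 < m" "m < 1" unfolding m by simp_all
      then show False by simp
    qed
    moreover have "X n \<noteq> ?s" for n
    proof
      assume "X n = ?s"
      then have "X n $ undefined \<in> \<int>" by simp
      with nint show False by blast
    qed
    ultimately have "?s islimpt ?A"
      unfolding islimpt_sequential by (intro exI[of _ X]) blast
    then show ?thesis by (simp add: trivial_limit_within)
  qed
  have "((\<lambda>z. (exp (2 * of_real pi * \<i> * z $ j) - 1) * Gamma (z $ j)) \<longlongrightarrow>
      2 * of_real pi * \<i> * ((-1) ^ l j / fact (l j))) (at ?s within ?A)" for j
  proof (rule filterlim_compose[OF prefactor_tendsto])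
    have "((\<lambda>z. z $ j) \<longlongrightarrow> ?s $ j) (at ?s within ?A)" by (intro tendsto_intros)
    moreover have "\<forall>\<^sub>F z in at ?s within ?A. z $ j \<noteq> - of_nat (l j)"
      unfolding eventually_at_filter
    proof (intro always_eventually allI impI notI)
      fix z assume "z \<in> ?A" "z $ j = - of_nat (l j)"
      moreover have "- of_nat (l j) \<in> (\<int>::complex set)" by simp
      ultimately show False by (metis mem_Collect_eq)
    qed
    ultimately show "filterlim (\<lambda>z. z $ j) (at (- of_nat (l j))) (at ?s within ?A)"
      by (simp add: filterlim_at)
  qed
  then have "((\<lambda>z. 1 / (\<Prod>j\<in>UNIV. (exp (2 * of_real pi * \<i> * z $ j) - 1) * Gamma (z $ j))
        * hankel_integral \<epsilon> \<xi> \<gamma> \<beta> z) \<longlongrightarrow>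
      1 / (\<Prod>j\<in>UNIV. 2 * of_real pi * \<i> * ((-1) ^ l j / fact (l j))) * hankel_integral \<epsilon> \<xi> \<gamma> \<beta> ?s)
      (at ?s within ?A)"
    by (intro tendsto_mult[OF tendsto_divide[OF tendsto_const tendsto_prod]]
      hankel_integral_continuous[OF e b av F]) auto
  then have "zeta_des \<epsilon> \<xi> \<gamma> \<beta> ?s =
      1 / (\<Prod>j\<in>UNIV. 2 * of_real pi * \<i> * ((-1) ^ l j / fact (l j))) * hankel_integral \<epsilon> \<xi> \<gamma> \<beta> ?s"
    unfolding zeta_des_def by (rule tendsto_Lim[OF nt])
  also have "1 / (\<Prod>j\<in>UNIV. 2 * of_real pi * \<i> * ((-1) ^ l j / fact (l j))) =
      (\<Prod>j\<in>UNIV. 1 / (2 * of_real pi * \<i> * ((-1) ^ l j / fact (l j))))"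
    by (simp add: prod_dividef)
  also have "\<dots> = (\<Prod>j\<in>UNIV. ((-1) ^ l j * fact (l j)) / (2 * of_real pi * \<i>))"
    by (intro prod.cong refl) (simp add: divide_simps flip: power_mult_distrib)
  also have "\<dots> = (\<Prod>j\<in>UNIV. (-1) ^ l j * fact (l j)) / (2 * of_real pi * \<i>) ^ CARD('d)"
    by (simp add: prod_dividef)
  finally show ?thesis .
qed

subsection \<open>Reduction to the torus\<close>

text \<open>By Fubini the j-th variable is integrated first; the reflection preserves Lebesgue
  measure, so the inner integral equals its own negative.\<close>

lemma integral_flip_antisymmetric:
  fixes f :: "('d::finite \<Rightarrow> real) \<Rightarrow> complex"
  assumes f: "integrable (PiM UNIV (\<lambda>_. lborel)) f"
    and anti: "\<And>t. f (t(j := a - t j)) = - f t"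
  shows "(LINT t | PiM UNIV (\<lambda>_. lborel). f t) = 0"
proof -
  interpret product_sigma_finite "\<lambda>_::'d. lborel::real measure" by standard
  have inner: "(LINT y | lborel. f (x(j := y))) = 0" for x
  proof -
    have "(LINT y | lborel. f (x(j := y))) = (LINT y | lborel. f (x(j := a + - 1 * y)))"
      using lborel_integral_real_affine[of "-1" "\<lambda>y. f (x(j := y))" a] by simp
    also have "\<dots> = (LINT y | lborel. - f (x(j := y)))"
    proof (rule Bochner_Integration.integral_cong[OF refl])
      show "f (x(j := a + - 1 * y)) = - f (x(j := y))" for y
        using anti[of "x(j := y)"] by simp
    qed
    finally show ?thesis by simp
  qed
  have "(LINT t | PiM (insert j (UNIV - {j})) (\<lambda>_. lborel). f t) =
      (LINT x | PiM (UNIV - {j}) (\<lambda>_. lborel). LINT y | lborel. f (x(j := y)))"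
    by (rule product_integral_insert) (use f in \<open>auto simp: insert_absorb\<close>)
  then show ?thesis by (simp add: inner insert_absorb)
qed

text \<open>The coordinates are cut down one at a time. The complement of [0, a] is invariant under
  the reflection, and the cutoffs \<open>g\<close> already made do not involve the new coordinate,
  so the discarded part is antisymmetric in it.\<close>

lemma integral_restrict_to_cube:
  fixes f :: "('d::finite \<Rightarrow> real) \<Rightarrow> complex"
  assumes f: "integrable (PiM UNIV (\<lambda>_. lborel)) f"
    and anti: "\<And>t j. t j \<notin> {0..a} \<Longrightarrow> f (t(j := a - t j)) = - f t"
  shows "(LINT t | PiM UNIV (\<lambda>_. lborel). f t) =
    (LINT t | PiM UNIV (\<lambda>_. lborel). (\<Prod>j\<in>UNIV. indicator {0..a} (t j)) * f t)"
proof -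
  let ?M = "PiM (UNIV::'d set) (\<lambda>_. lborel :: real measure)"
  have fm [measurable]: "f \<in> borel_measurable ?M" using f by (rule borel_measurable_integrable)
  have cut: "integrable ?M (\<lambda>t. g t * f t)"
    if [measurable]: "g \<in> borel_measurable ?M" and "\<And>t. norm (g t) \<le> 1" for g :: "('d \<Rightarrow> real) \<Rightarrow> complex"
  proof (rule Bochner_Integration.integrable_bound[OF f])
    show "AE t in ?M. norm (g t * f t) \<le> norm (f t)"
      using that(2) by (intro AE_I2) (auto simp: norm_mult intro: mult_left_le_one_le)
  qed measurable
  have "(LINT t | ?M. f t) = (LINT t | ?M. (\<Prod>j\<in>J. indicator {0..a} (t j)) * f t)" if "finite J" for J
    using that
  proof (induction J rule: finite_induct)
    case (insert i J)
    define g where "g t = (\<Prod>j\<in>J. indicator {0..a} (t j) :: complex)" for t :: "'d \<Rightarrow> real"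
    have [measurable]: "g \<in> borel_measurable ?M" unfolding g_def by measurable
    have ng: "norm (g t) \<le> 1" for t
      unfolding g_def prod_norm[symmetric]
      by (intro prod_le_1) (auto simp: indicator_def)
    have ind: "norm (indicator A x :: complex) \<le> 1" for A and x :: real by (simp add: indicator_def)
    have 1: "integrable ?M (\<lambda>t. (indicator {0..a} (t i) * g t) * f t)"
      by (rule cut) (auto simp: norm_mult intro!: mult_le_one ng ind)
    have 2: "integrable ?M (\<lambda>t. (indicator (- {0..a}) (t i) * g t) * f t)"
      by (rule cut) (auto simp: norm_mult intro!: mult_le_one ng ind)
    have "(LINT t | ?M. (indicator (- {0..a}) (t i) * g t) * f t) = 0"
    proof (rule integral_flip_antisymmetric[OF 2, where j = i and a = a])
      fix t :: "'d \<Rightarrow> real"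
      have "g (t(i := a - t i)) = g t"
        unfolding g_def using insert.hyps by (intro prod.cong) auto
      then show "indicator (- {0..a}) ((t(i := a - t i)) i) * g (t(i := a - t i)) * f (t(i := a - t i)) =
          - (indicator (- {0..a}) (t i) * g t * f t)"
        using anti[of t i] by (auto simp: indicator_def)
    qed
    moreover have "(LINT t | ?M. g t * f t) =
        (LINT t | ?M. (indicator {0..a} (t i) * g t) * f t + (indicator (- {0..a}) (t i) * g t) * f t)"
      by (intro Bochner_Integration.integral_cong) (auto simp: indicator_def)
    ultimately show ?case
      using insert Bochner_Integration.integral_add[OF 1 2] by (simp add: g_def)
  qed simp
  then show ?thesis by simp
qed

text \<open>An integer multiple of the logarithm forgets the branch, so the power depends on the
  contour point alone. The exponent is \<open>Suc n\<close> because s - 1 = - n - 1.\<close>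

lemma exp_hankel_log_neg_int:
  "exp ((- of_nat n - 1) * hankel_log \<epsilon> t) = 1 / hankel \<epsilon> t ^ Suc n"
proof -
  have "(- of_nat n - 1) * hankel_log \<epsilon> t = - (of_nat (Suc n) * hankel_log \<epsilon> t)"
    by (simp add: algebra_simps)
  then show ?thesis
    by (simp only: exp_minus exp_of_nat_mult hankel_def inverse_eq_divide)
qed

text \<open>At these s the integrand depends on t only through the contour points, which the
  reflection fixes, and through the product of derivatives, in which exactly one factor changes
  sign.\<close>

lemma hankel_integrand_flip:
  fixes \<xi> :: "complex^'r" and \<gamma> :: "complex^'r^'d" and l :: "'d \<Rightarrow> nat"
  assumes e: "\<epsilon> > 0" and t: "t j \<notin> {0..2*pi}"
  shows "hankel_integrand \<epsilon> \<xi> \<gamma> \<beta> (\<chi> j. - of_nat (l j)) (t(j := 2 * pi - t j)) =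
    - hankel_integrand \<epsilon> \<xi> \<gamma> \<beta> (\<chi> j. - of_nat (l j)) t"
proof -
  let ?t = "t(j := 2 * pi - t j)"
  have h: "hankel \<epsilon> (?t i) = hankel \<epsilon> (t i)" for i
    using hankel_flip(1)[OF e, of "t j"] t by auto
  have "(\<Prod>i\<in>UNIV. hankel_deriv \<epsilon> (?t i)) = hankel_deriv \<epsilon> (?t j) * (\<Prod>i\<in>UNIV-{j}. hankel_deriv \<epsilon> (?t i))"
    by (rule prod.remove) auto
  also have "\<dots> = - (hankel_deriv \<epsilon> (t j) * (\<Prod>i\<in>UNIV-{j}. hankel_deriv \<epsilon> (t i)))"
    using hankel_flip(2)[OF e, of "t j"] t by auto
  also have "\<dots> = - (\<Prod>i\<in>UNIV. hankel_deriv \<epsilon> (t i))"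
    by (subst prod.remove[of UNIV j]) auto
  finally show ?thesis
    unfolding hankel_integrand_def vec_lambda_beta exp_hankel_log_neg_int h prod.distrib
    by (simp only: mult_minus_left mult_minus_right)
qed

text \<open>On the circle dx = i x dt, so x^(- l - 1) dx becomes i x^(- l) dt.\<close>

lemma hankel_integral_neg_int:
  fixes \<xi> :: "complex^'r" and \<gamma> :: "complex^'r^'d" and \<beta> :: "complex^'d" and l :: "'d \<Rightarrow> nat"
  assumes e: "\<epsilon> > 0" and b: "\<And>j. Re (\<beta> $ j) > 0" and av: "hankel_avoids_poles \<epsilon> \<xi> \<gamma>"
    and F: "des_F_contour_bounded \<epsilon> \<xi> \<gamma>"
  shows "hankel_integral \<epsilon> \<xi> \<gamma> \<beta> (\<chi> j. - of_nat (l j)) =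
    (LINT t | PiM UNIV (\<lambda>_. lborel).
      (\<Prod>j\<in>UNIV. indicator {0..2*pi} (t j) * (\<i> / (of_real \<epsilon> * exp (\<i> * of_real (t j))) ^ l j)) *
      (\<Prod>j\<in>UNIV. exp (((\<Sum>k\<in>UNIV. \<gamma> $ j $ k) - \<beta> $ j) * (of_real \<epsilon> * exp (\<i> * of_real (t j))))) *
      (\<Prod>k\<in>UNIV. des_F (des_delta (\<xi> $ k)) (\<xi> $ k)
         (\<Sum>j\<in>UNIV. \<gamma> $ j $ k * (of_real \<epsilon> * exp (\<i> * of_real (t j))))))"
proof -
  have "hankel_integral \<epsilon> \<xi> \<gamma> \<beta> (\<chi> j. - of_nat (l j)) =
    (LINT t | PiM UNIV (\<lambda>_. lborel). (\<Prod>j\<in>UNIV. indicator {0..2*pi} (t j)) *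
      hankel_integrand \<epsilon> \<xi> \<gamma> \<beta> (\<chi> j. - of_nat (l j)) t)"
    unfolding hankel_integral_eq
    by (rule integral_restrict_to_cube[OF hankel_integrand_integrable[OF e b av F]])
       (rule hankel_integrand_flip[OF e])
  also have "\<dots> = (LINT t | PiM UNIV (\<lambda>_. lborel).
      (\<Prod>j\<in>UNIV. indicator {0..2*pi} (t j) * (\<i> / (of_real \<epsilon> * exp (\<i> * of_real (t j))) ^ l j)) *
      (\<Prod>j\<in>UNIV. exp (((\<Sum>k\<in>UNIV. \<gamma> $ j $ k) - \<beta> $ j) * (of_real \<epsilon> * exp (\<i> * of_real (t j))))) *
      (\<Prod>k\<in>UNIV. des_F (des_delta (\<xi> $ k)) (\<xi> $ k)
         (\<Sum>j\<in>UNIV. \<gamma> $ j $ k * (of_real \<epsilon> * exp (\<i> * of_real (t j))))))"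
  proof (rule Bochner_Integration.integral_cong[OF refl])
    fix t :: "'d \<Rightarrow> real"
    show "(\<Prod>j\<in>UNIV. indicator {0..2*pi} (t j)) *
      hankel_integrand \<epsilon> \<xi> \<gamma> \<beta> (\<chi> j. - of_nat (l j)) t =
      (\<Prod>j\<in>UNIV. indicator {0..2*pi} (t j) * (\<i> / (of_real \<epsilon> * exp (\<i> * of_real (t j))) ^ l j)) *
      (\<Prod>j\<in>UNIV. exp (((\<Sum>k\<in>UNIV. \<gamma> $ j $ k) - \<beta> $ j) * (of_real \<epsilon> * exp (\<i> * of_real (t j))))) *
      (\<Prod>k\<in>UNIV. des_F (des_delta (\<xi> $ k)) (\<xi> $ k)
         (\<Sum>j\<in>UNIV. \<gamma> $ j $ k * (of_real \<epsilon> * exp (\<i> * of_real (t j)))))"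
    proof (cases "\<forall>j. t j \<in> {0..2*pi}")
      case True
      then have t: "0 \<le> t j" "\<not> t j < 0" "t j \<le> 2 * pi" for j by (auto simp: not_less)
      have h: "hankel \<epsilon> (t j) = of_real \<epsilon> * exp (\<i> * of_real (t j))" for j
        using e t[of j] by (simp add: hankel_eq)
      have d: "hankel_deriv \<epsilon> (t j) = \<i> * hankel \<epsilon> (t j)" for j
        using t[of j] by (simp add: hankel_deriv_def)
      have i: "indicator {0..2*pi} (t j) = (1::complex)" for j using t[of j] by simp
      have nz: "hankel \<epsilon> (t j) \<noteq> 0" for j by (simp add: hankel_def)
      have c: "1 / z ^ Suc n * E * (\<i> * z) = \<i> / z ^ n * E" if "z \<noteq> 0" for z E :: complex and n
        using that by simp
      show ?thesis
        unfolding hankel_integrand_def vec_lambda_beta exp_hankel_log_neg_int d i c[OF nz]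
        unfolding prod.distrib h by (simp only: prod.neutral_const mult_1)
    next
      case False
      then obtain j where "t j \<notin> {0..2*pi}" by blast
      then have j: "indicator {0..2*pi} (t j) = (0::complex)" by simp
      have "(\<Prod>j\<in>UNIV. indicator {0..2*pi} (t j) :: complex) = 0"
        using j by (intro prod_zero bexI[of _ j]) auto
      moreover have "(\<Prod>j\<in>UNIV. indicator {0..2*pi} (t j) * (\<i> / (of_real \<epsilon> * exp (\<i> * of_real (t j))) ^ l j)) = 0"
        using j by (intro prod_zero bexI[of _ j]) auto
      ultimately show ?thesis by (simp only: mult_zero_left)
    qed
  qed
  finally show ?thesis .
qed

subsection \<open>Monomial expansion\<close>

lemma finite_compositions:
  assumes "finite J"
  shows "finite {\<nu>::'d \<Rightarrow> nat. (\<forall>j. j \<notin> J \<longrightarrow> \<nu> j = 0) \<and> sum \<nu> J \<le> n}"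
proof (rule finite_subset)
  show "finite {\<nu>::'d \<Rightarrow> nat. \<forall>j. (j \<in> J \<longrightarrow> \<nu> j \<in> {..n}) \<and> (j \<notin> J \<longrightarrow> \<nu> j = 0)}"
    using assms by (intro finite_set_of_finite_funs) auto
  show "{\<nu>::'d \<Rightarrow> nat. (\<forall>j. j \<notin> J \<longrightarrow> \<nu> j = 0) \<and> sum \<nu> J \<le> n} \<subseteq>
      {\<nu>. \<forall>j. (j \<in> J \<longrightarrow> \<nu> j \<in> {..n}) \<and> (j \<notin> J \<longrightarrow> \<nu> j = 0)}"
  proof safe
    fix \<nu> :: "'d \<Rightarrow> nat" and j assume "sum \<nu> J \<le> n" "j \<in> J"
    then show "\<nu> j \<le> n" using member_le_sum[of j J \<nu>] assms by simp
  qed blast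
qed

text \<open>Multinomial theorem in divided powers, where the binomial theorem for one more summand
  has no coefficients left. Exponents vanish outside \<open>J\<close>, so each composition is
  represented by exactly one function.\<close>

lemma multinomial_divided:
  fixes z :: "'d \<Rightarrow> complex"
  assumes "finite J"
  shows "(\<Sum>j\<in>J. z j) ^ n / fact n =
    (\<Sum>\<nu> | (\<forall>j. j \<notin> J \<longrightarrow> \<nu> j = 0) \<and> sum \<nu> J = n. \<Prod>j\<in>J. z j ^ \<nu> j / fact (\<nu> j))"
  using assms
proof (induction J arbitrary: n rule: finite_induct)
  case empty
  have "{\<nu>::'d \<Rightarrow> nat. (\<forall>j. \<nu> j = 0) \<and> n = 0} = (if n = 0 then {\<lambda>_. 0} else {})" by auto
  then show ?case by simp
next
  case (insert i J)
  define M where "M J n = {\<nu>::'d \<Rightarrow> nat. (\<forall>j. j \<notin> J \<longrightarrow> \<nu> j = 0) \<and> sum \<nu> J = n}" for J n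
  have finM: "finite (M J n)" for n
    by (rule finite_subset[OF _ finite_compositions[OF insert.hyps(1), of n]]) (auto simp: M_def)
  have "(\<Sum>j\<in>insert i J. z j) ^ n / fact n =
      (\<Sum>m\<le>n. of_nat (n choose m) * z i ^ m * (\<Sum>j\<in>J. z j) ^ (n - m)) / fact n"
    using insert.hyps by (simp add: binomial_ring)
  also have "\<dots> = (\<Sum>m\<le>n. z i ^ m / fact m * ((\<Sum>j\<in>J. z j) ^ (n - m) / fact (n - m)))"
    unfolding sum_divide_distrib by (intro sum.cong refl) (simp add: binomial_fact)
  also have "\<dots> = (\<Sum>m\<le>n. \<Sum>\<nu>\<in>M J (n - m). z i ^ m / fact m * (\<Prod>j\<in>J. z j ^ \<nu> j / fact (\<nu> j)))"
    by (simp add: insert.IH M_def sum_distrib_left)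
  also have "\<dots> = (\<Sum>(m, \<nu>)\<in>(SIGMA m:{..n}. M J (n - m)).
      z i ^ m / fact m * (\<Prod>j\<in>J. z j ^ \<nu> j / fact (\<nu> j)))"
    by (rule sum.Sigma) (auto intro: finM)
  also have "\<dots> = (\<Sum>\<nu>\<in>M (insert i J) n. \<Prod>j\<in>insert i J. z j ^ \<nu> j / fact (\<nu> j))"
  \<comment> \<open>The exponent \<open>m\<close> of the new summand is stored at \<open>i\<close>;
    the inverse resets that entry to 0, as membership in \<open>M J\<close> demands.\<close>
  proof (rule sum.reindex_bij_witness[where i = "\<lambda>\<nu>. (\<nu> i, \<nu>(i := 0))" and j = "\<lambda>(m, \<nu>). \<nu>(i := m)"])
    have upd: "sum (\<nu>(i := m)) J = sum \<nu> J" "(\<Prod>j\<in>J. z j ^ (\<nu>(i := m)) j / fact ((\<nu>(i := m)) j)) =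
        (\<Prod>j\<in>J. z j ^ \<nu> j / fact (\<nu> j))" for \<nu> :: "'d \<Rightarrow> nat" and m
      using insert.hyps by (auto intro!: sum.cong prod.cong)
    fix a assume a: "a \<in> (SIGMA m:{..n}. M J (n - m))"
    then obtain m \<nu> where m: "a = (m, \<nu>)" "m \<le> n" "\<And>j. j \<notin> J \<Longrightarrow> \<nu> j = 0" "sum \<nu> J = n - m"
      by (auto simp: M_def)
    show "(case a of (m, \<nu>) \<Rightarrow> \<nu>(i := m)) \<in> M (insert i J) n"
      using m insert.hyps upd(1)[of \<nu> m] by (simp add: M_def)
    show "((case a of (m, \<nu>) \<Rightarrow> \<nu>(i := m)) i, (case a of (m, \<nu>) \<Rightarrow> \<nu>(i := m))(i := 0)) = a"
      using m insert.hyps by (auto simp: fun_eq_iff)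
    show "(\<Prod>j\<in>insert i J. z j ^ (case a of (m, \<nu>) \<Rightarrow> \<nu>(i := m)) j / fact ((case a of (m, \<nu>) \<Rightarrow> \<nu>(i := m)) j)) =
        (case a of (m, \<nu>) \<Rightarrow> z i ^ m / fact m * (\<Prod>j\<in>J. z j ^ \<nu> j / fact (\<nu> j)))"
      using m(1) insert.hyps upd(2)[of \<nu> m] by simp
  next
    fix \<nu> assume "\<nu> \<in> M (insert i J) n"
    moreover have "sum (\<nu>(i := 0)) J = sum \<nu> J" using insert.hyps by (auto intro!: sum.cong)
    ultimately show "(\<nu> i, \<nu>(i := 0)) \<in> (SIGMA m:{..n}. M J (n - m))"
      using insert.hyps by (auto simp: M_def)
    show "(case (\<nu> i, \<nu>(i := 0)) of (m, \<nu>) \<Rightarrow> \<nu>(i := m)) = \<nu>" by simp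
  qed
  finally show ?case by (simp add: M_def)
qed

text \<open>The multi-indices are grouped by total degree; this makes a truncated series in the sum
  a polynomial in the separate variables.\<close>

lemma truncated_series_of_sum:
  fixes z :: "'d::finite \<Rightarrow> complex"
  shows "(\<Sum>n\<le>N. a n / fact n * (\<Sum>j\<in>UNIV. z j) ^ n) =
    (\<Sum>\<nu> | sum \<nu> UNIV \<le> N. a (sum \<nu> UNIV) * (\<Prod>j\<in>UNIV. z j ^ \<nu> j / fact (\<nu> j)))"
proof -
  let ?A = "{\<nu>::'d \<Rightarrow> nat. sum \<nu> UNIV \<le> N}"
  have fin: "finite ?A" using finite_compositions[of "UNIV::'d set" N] by simp
  have "(\<Sum>n\<le>N. a n / fact n * (\<Sum>j\<in>UNIV. z j) ^ n) =
      (\<Sum>n\<le>N. \<Sum>\<nu>\<in>{\<nu>\<in>?A. sum \<nu> UNIV = n}. a (sum \<nu> UNIV) * (\<Prod>j\<in>UNIV. z j ^ \<nu> j / fact (\<nu> j)))"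
  proof (rule sum.cong[OF refl])
    fix n assume "n \<in> {..N}"
    then have S: "{\<nu>\<in>?A. sum \<nu> UNIV = n} = {\<nu>. sum \<nu> UNIV = n}" by auto
    have "a n / fact n * (\<Sum>j\<in>UNIV. z j) ^ n = a n * ((\<Sum>j\<in>UNIV. z j) ^ n / fact n)" by simp
    also have "\<dots> = (\<Sum>\<nu> | sum \<nu> UNIV = n. a n * (\<Prod>j\<in>UNIV. z j ^ \<nu> j / fact (\<nu> j)))"
      by (subst multinomial_divided) (simp_all add: sum_distrib_left)
    also have "\<dots> = (\<Sum>\<nu>\<in>{\<nu>\<in>?A. sum \<nu> UNIV = n}.
        a (sum \<nu> UNIV) * (\<Prod>j\<in>UNIV. z j ^ \<nu> j / fact (\<nu> j)))"
      unfolding S by (intro sum.cong) auto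
    finally show "a n / fact n * (\<Sum>j\<in>UNIV. z j) ^ n = \<dots>" .
  qed
  also have "\<dots> = (\<Sum>\<nu>\<in>?A. a (sum \<nu> UNIV) * (\<Prod>j\<in>UNIV. z j ^ \<nu> j / fact (\<nu> j)))"
    by (rule sum.group) (use fin in auto)
  finally show ?thesis .
qed

text \<open>The integrand is a multiple of exp (i (n - l) t), whose primitive \<open>H\<close> is 2
  pi-periodic unless n = l, when the integrand is constant and the powers of \<epsilon>
  cancel.\<close>

lemma circle_integral_monomial:
  fixes \<epsilon> :: real and l n :: nat
  assumes e: "\<epsilon> > 0"
  defines "f \<equiv> \<lambda>t. indicator {0..2*pi} t *
      (\<i> / (of_real \<epsilon> * exp (\<i> * of_real t)) ^ l * (of_real \<epsilon> * exp (\<i> * of_real t)) ^ n)"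
  shows "integrable lborel f"
    and "integral\<^sup>L lborel f = (if n = l then 2 * of_real pi * \<i> else 0)"
proof -
  define g where "g t = \<i> / (of_real \<epsilon> * exp (\<i> * of_real t)) ^ l * (of_real \<epsilon> * exp (\<i> * of_real t)) ^ n" for t :: real
  define c where "c = \<i> * (of_nat n - of_nat l)"
  define K where "K = \<i> * of_real \<epsilon> ^ n / complex_of_real \<epsilon> ^ l"
  have g: "g t = K * exp (c * of_real t)" for t
    by (simp add: g_def c_def K_def power_mult_distrib exp_diff algebra_simps flip: exp_of_nat_mult)
  have f: "f = (\<lambda>t. indicator {0..2*pi} t *\<^sub>R g t)"
    by (auto simp: f_def g_def indicator_def)
  have cont: "continuous_on {0..2*pi} g" unfolding g by (intro continuous_intros)
  define H where "H t = (if n = l then K * of_real t else K * exp (c * of_real t) / c)" for t :: real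
  have d: "(H has_vector_derivative g t) (at t within {0..2*pi})" for t
  proof (cases "n = l")
    case True
    have "((\<lambda>t. K * of_real t) has_vector_derivative K * of_real 1) (at t within {0..2*pi})"
      by (intro has_vector_derivative_mult_right has_vector_derivative_of_real) (auto intro!: derivative_intros)
    then show ?thesis using True by (simp add: H_def[abs_def] g c_def)
  next
    case False
    then have c: "c \<noteq> 0" by (simp add: c_def)
    have "((\<lambda>z. K * exp (c * z) / c) has_field_derivative K * exp (c * of_real t)) (at (of_real t))"
      using c by (auto intro!: derivative_eq_intros)
    then have "((\<lambda>t. K * exp (c * of_real t) / c) has_vector_derivative K * exp (c * of_real t)) (at t within {0..2*pi})"
      by (rule has_vector_derivative_real_field)
    then show ?thesis using False by (simp add: H_def[abs_def] g)
  qed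
  have hb: "has_bochner_integral lborel f (H (2*pi) - H 0)"
    unfolding f by (rule has_bochner_integral_FTC_Icc[OF _ d cont]) auto
  show "integrable lborel f" using hb by (simp add: has_bochner_integral_iff)
  have "H (2*pi) - H 0 = (if n = l then 2 * of_real pi * \<i> else 0)"
  proof (cases "n = l")
    case True
    then show ?thesis using e by (simp add: H_def K_def)
  next
    case False
    have "exp (c * of_real (2 * pi)) = exp (of_int (2 * (int n - int l)) * (of_real pi * \<i>))"
      by (simp add: c_def algebra_simps)
    also have "\<dots> = 1" by (subst exp_eq_1) (auto intro!: exI[of _ "int n - int l"])
    finally show ?thesis using False by (simp add: H_def)
  qed
  then show "integral\<^sup>L lborel f = (if n = l then 2 * of_real pi * \<i> else 0)"
    using hb by (simp add: has_bochner_integral_iff)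
qed

subsection \<open>Torus integrals\<close>

text \<open>After expansion into monomials each integral factors over the variables, and only the
  monomials of degree exactly \<open>l j\<close> in every x_j survive.\<close>

lemma torus_integral_truncated:
  fixes a :: "'r::finite \<Rightarrow> nat \<Rightarrow> complex" and \<gamma> :: "complex^'r^'d" and c :: "'d \<Rightarrow> complex"
    and l :: "'d \<Rightarrow> nat" and \<epsilon> :: real
  assumes e: "\<epsilon> > 0" and N: "(\<Sum>j\<in>UNIV. l j) \<le> N"
  defines "x \<equiv> \<lambda>t. of_real \<epsilon> * exp (\<i> * of_real t)"
  shows "(LINT t | PiM UNIV (\<lambda>_. lborel).
      (\<Prod>j\<in>UNIV. indicator {0..2*pi} (t j) * (\<i> / x (t j) ^ l j)) *
      (\<Prod>j\<in>UNIV. \<Sum>m\<le>N. (c j * x (t j)) ^ m / fact m) *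
      (\<Prod>k\<in>UNIV. \<Sum>n\<le>N. a k n / fact n * (\<Sum>j\<in>UNIV. \<gamma> $ j $ k * x (t j)) ^ n)) =
    (2 * of_real pi * \<i>) ^ CARD('d) *
      (\<Sum>(m, \<nu>) \<in> {(m :: 'd \<Rightarrow> nat, \<nu> :: 'd \<Rightarrow> 'r \<Rightarrow> nat). \<forall>j. m j + (\<Sum>k\<in>UNIV. \<nu> j k) = l j}.
         (\<Prod>k\<in>UNIV. a k (\<Sum>j\<in>UNIV. \<nu> j k)) *
         (\<Prod>j\<in>UNIV. c j ^ m j / fact (m j)) *
         (\<Prod>j\<in>UNIV. \<Prod>k\<in>UNIV. (\<gamma> $ j $ k) ^ \<nu> j k / fact (\<nu> j k)))"
proof -
  interpret product_sigma_finite "\<lambda>_::'d. lborel::real measure" by standard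
  let ?M = "PiM (UNIV::'d set) (\<lambda>_. lborel :: real measure)"
  \<comment> \<open>The expansion picks an exponent \<open>m j\<close> from each exponential series
    and a multi-index \<open>\<mu> k\<close> of total degree at most \<open>N\<close> from each F.
    The resulting exponent of x_j is \<open>ex m \<mu> j\<close>.\<close>
  define A where "A = {\<nu>::'d \<Rightarrow> nat. sum \<nu> UNIV \<le> N}"
  define B where "B = PiE (UNIV::'d set) (\<lambda>_. {..N})"
  define D where "D = PiE (UNIV::'r set) (\<lambda>_. A)"
  have finA: "finite A" unfolding A_def using finite_compositions[of "UNIV::'d set" N] by simp
  have finB: "finite B" unfolding B_def by (intro finite_PiE) auto
  have finD: "finite D" unfolding D_def using finA by (intro finite_PiE) auto
  define coef where "coef m \<mu> = (\<Prod>k\<in>UNIV. a k (sum (\<mu> k) UNIV)) * (\<Prod>j\<in>UNIV. c j ^ m j / fact (m j)) *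
     (\<Prod>j\<in>UNIV. \<Prod>k\<in>UNIV. (\<gamma> $ j $ k) ^ \<mu> k j / fact (\<mu> k j))" for m :: "'d \<Rightarrow> nat" and \<mu> :: "'r \<Rightarrow> 'd \<Rightarrow> nat"
  define ex where "ex m \<mu> j = m j + (\<Sum>k\<in>UNIV. \<mu> k j)"
    for m :: "'d \<Rightarrow> nat" and \<mu> :: "'r \<Rightarrow> 'd \<Rightarrow> nat" and j
  have expand: "(\<Prod>j\<in>UNIV. \<Sum>m\<le>N. (c j * X j) ^ m / fact m) *
      (\<Prod>k\<in>UNIV. \<Sum>n\<le>N. a k n / fact n * (\<Sum>j\<in>UNIV. \<gamma> $ j $ k * X j) ^ n) =
      (\<Sum>(m, \<mu>)\<in>B \<times> D. coef m \<mu> * (\<Prod>j\<in>UNIV. X j ^ ex m \<mu> j))" for X :: "'d \<Rightarrow> complex"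
  proof -
    have 1: "(\<Prod>j\<in>UNIV. \<Sum>m\<le>N. (c j * X j) ^ m / fact m) =
        (\<Sum>m\<in>B. \<Prod>j\<in>UNIV. (c j * X j) ^ m j / fact (m j))"
      unfolding B_def by (rule prod_sum_PiE) auto
    have 2: "(\<Prod>k\<in>UNIV. \<Sum>n\<le>N. a k n / fact n * (\<Sum>j\<in>UNIV. \<gamma> $ j $ k * X j) ^ n) =
        (\<Sum>\<mu>\<in>D. \<Prod>k\<in>UNIV. a k (sum (\<mu> k) UNIV) * (\<Prod>j\<in>UNIV. (\<gamma> $ j $ k * X j) ^ \<mu> k j / fact (\<mu> k j)))"
      unfolding truncated_series_of_sum D_def A_def[symmetric]
      by (rule prod_sum_PiE) (auto simp: finA)
    have 3: "(\<Prod>j\<in>UNIV. (c j * X j) ^ m j / fact (m j)) *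
        (\<Prod>k\<in>UNIV. a k (sum (\<mu> k) UNIV) * (\<Prod>j\<in>UNIV. (\<gamma> $ j $ k * X j) ^ \<mu> k j / fact (\<mu> k j)))
        = coef m \<mu> * (\<Prod>j\<in>UNIV. X j ^ ex m \<mu> j)" for m \<mu>
    proof -
      have "(\<Prod>j\<in>UNIV. (c j * X j) ^ m j / fact (m j)) =
          (\<Prod>j\<in>UNIV. c j ^ m j / fact (m j)) * (\<Prod>j\<in>UNIV. X j ^ m j)"
        by (simp add: power_mult_distrib flip: prod.distrib)
      moreover have "(\<Prod>k\<in>UNIV. \<Prod>j\<in>UNIV. (\<gamma> $ j $ k * X j) ^ \<mu> k j / fact (\<mu> k j)) =
          (\<Prod>j\<in>UNIV. \<Prod>k\<in>UNIV. (\<gamma> $ j $ k) ^ \<mu> k j / fact (\<mu> k j)) * (\<Prod>j\<in>UNIV. X j ^ (\<Sum>k\<in>UNIV. \<mu> k j))"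
        unfolding power_sum by (subst prod.swap) (simp add: power_mult_distrib flip: prod.distrib)
      ultimately show ?thesis
        by (simp only: prod.distrib coef_def ex_def power_add mult_ac)
    qed
    show ?thesis unfolding 1 2 sum_product 3 by (rule sum.cartesian_product)
  qed
  define w where "w m \<mu> j t = indicator {0..2*pi} t * (\<i> / x t ^ l j * x t ^ ex m \<mu> j)" for m \<mu> j t
  have wi: "integrable lborel (w m \<mu> j)"
    and wI: "integral\<^sup>L lborel (w m \<mu> j) = (if ex m \<mu> j = l j then 2 * of_real pi * \<i> else 0)" for m \<mu> j
    unfolding w_def x_def using circle_integral_monomial[OF e] by blast+
  have "(LINT t | ?M.
      (\<Prod>j\<in>UNIV. indicator {0..2*pi} (t j) * (\<i> / x (t j) ^ l j)) *
      (\<Prod>j\<in>UNIV. \<Sum>m\<le>N. (c j * x (t j)) ^ m / fact m) *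
      (\<Prod>k\<in>UNIV. \<Sum>n\<le>N. a k n / fact n * (\<Sum>j\<in>UNIV. \<gamma> $ j $ k * x (t j)) ^ n)) =
      (LINT t | ?M. (\<Sum>p\<in>B \<times> D. coef (fst p) (snd p) * (\<Prod>j\<in>UNIV. w (fst p) (snd p) j (t j))))"
    unfolding mult.assoc expand sum_distrib_left
    by (intro Bochner_Integration.integral_cong sum.cong refl)
       (simp only: w_def prod.distrib case_prod_beta mult_ac)
  also have "\<dots> = (\<Sum>p\<in>B \<times> D. (LINT t | ?M. coef (fst p) (snd p) * (\<Prod>j\<in>UNIV. w (fst p) (snd p) j (t j))))"
    by (intro Bochner_Integration.integral_sum integrable_mult_right product_integrable_prod wi) auto
  also have "\<dots> = (\<Sum>p\<in>B \<times> D. if \<forall>j. ex (fst p) (snd p) j = l j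
      then (2 * of_real pi * \<i>) ^ CARD('d) * coef (fst p) (snd p) else 0)"
  proof (rule sum.cong[OF refl])
    fix p :: "('d \<Rightarrow> nat) \<times> ('r \<Rightarrow> 'd \<Rightarrow> nat)"
    have "(LINT t | ?M. (\<Prod>j\<in>UNIV. w (fst p) (snd p) j (t j))) =
        (\<Prod>j\<in>UNIV. if ex (fst p) (snd p) j = l j then 2 * of_real pi * \<i> else 0)"
      by (subst product_integral_prod) (auto intro: wi simp: wI)
    also have "\<dots> = (if \<forall>j. ex (fst p) (snd p) j = l j then (2 * of_real pi * \<i>) ^ CARD('d) else 0)"
      by (auto intro!: prod_zero)
    finally show "(LINT t | ?M. coef (fst p) (snd p) * (\<Prod>j\<in>UNIV. w (fst p) (snd p) j (t j))) =
        (if \<forall>j. ex (fst p) (snd p) j = l j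
         then (2 * of_real pi * \<i>) ^ CARD('d) * coef (fst p) (snd p) else 0)"
      by (simp add: mult.commute)
  qed
  also have "\<dots> = (\<Sum>p\<in>{p\<in>B \<times> D. \<forall>j. ex (fst p) (snd p) j = l j}.
      (2 * of_real pi * \<i>) ^ CARD('d) * coef (fst p) (snd p))"
    by (rule sum.inter_filter[symmetric]) (use finB finD in auto)
  also have "{p\<in>B \<times> D. \<forall>j. ex (fst p) (snd p) j = l j} = {p. \<forall>j. ex (fst p) (snd p) j = l j}"
  proof -
    \<comment> \<open>This is where \<open>N\<close> must be at least the sum of the
      \<open>l j\<close>: every solution of the degree equations survives the truncation, since
      \<open>m j \<le> l j\<close> and \<open>\<mu> k\<close> is bounded entrywise by
      \<open>l\<close>.\<close>
    have "m \<in> B \<and> \<mu> \<in> D" if "\<forall>j. ex m \<mu> j = l j" for m \<mu>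
    proof -
      have lN: "l j \<le> N" for j using member_le_sum[of j UNIV l] N by simp
      have "m j \<le> N" for j using that lN[of j] by (auto simp: ex_def dest: spec[of _ j])
      moreover have "sum (\<mu> k) UNIV \<le> N" for k
      proof -
        have "\<mu> k j \<le> l j" for j
          using spec[OF that, of j] member_le_sum[of k UNIV "\<lambda>k. \<mu> k j"] by (simp add: ex_def)
        then have "sum (\<mu> k) UNIV \<le> sum l UNIV" by (intro sum_mono)
        then show ?thesis using N by linarith
      qed
      ultimately show ?thesis by (auto simp: A_def B_def D_def)
    qed
    then show ?thesis by auto
  qed
  also have "(\<Sum>p\<in>\<dots>. (2 * of_real pi * \<i>) ^ CARD('d) * coef (fst p) (snd p)) =
      (2 * of_real pi * \<i>) ^ CARD('d) * (\<Sum>p | \<forall>j. ex (fst p) (snd p) j = l j. coef (fst p) (snd p))"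
    by (rule sum_distrib_left[symmetric])
  \<comment> \<open>Only a transposition: \<open>\<mu>\<close> is indexed by k first, as it arose
    from the functions F, and \<open>\<nu>\<close> by j first.\<close>
  also have "(\<Sum>p | \<forall>j. ex (fst p) (snd p) j = l j. coef (fst p) (snd p)) =
      (\<Sum>(m, \<nu>) \<in> {(m :: 'd \<Rightarrow> nat, \<nu> :: 'd \<Rightarrow> 'r \<Rightarrow> nat). \<forall>j. m j + (\<Sum>k\<in>UNIV. \<nu> j k) = l j}.
         (\<Prod>k\<in>UNIV. a k (\<Sum>j\<in>UNIV. \<nu> j k)) *
         (\<Prod>j\<in>UNIV. c j ^ m j / fact (m j)) *
         (\<Prod>j\<in>UNIV. \<Prod>k\<in>UNIV. (\<gamma> $ j $ k) ^ \<nu> j k / fact (\<nu> j k)))"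
    by (rule sum.reindex_bij_witness[where i = "\<lambda>(m, \<nu>). (m, \<lambda>k j. \<nu> j k)" and j = "\<lambda>(m, \<mu>). (m, \<lambda>j k. \<mu> k j)"])
       (auto simp: coef_def ex_def)
  finally show ?thesis .
qed

text \<open>
  Truncating all series at order \<open>N\<close> leaves finite sums of monomials, whose torus integrals do not
  depend on \<open>N\<close> once \<open>N\<close> is large; the truncations converge boundedly on the torus.
\<close>

lemma torus_integral:
  fixes a :: "'r::finite \<Rightarrow> nat \<Rightarrow> complex" and \<gamma> :: "complex^'r^'d" and c :: "'d \<Rightarrow> complex"
    and l :: "'d \<Rightarrow> nat" and \<epsilon> :: real and G :: "'r \<Rightarrow> real"
  assumes e: "\<epsilon> > 0"
    and G: "\<And>k. (\<Sum>j\<in>UNIV. norm (\<gamma> $ j $ k)) * \<epsilon> \<le> G k"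
    and sums: "\<And>k y. norm y \<le> G k \<Longrightarrow> (\<lambda>n. a k n / fact n * y ^ n) sums F k y"
    and summable: "\<And>k. summable (\<lambda>n. norm (a k n / fact n) * G k ^ n)"
  defines "x \<equiv> \<lambda>t. of_real \<epsilon> * exp (\<i> * of_real t)"
  shows "(LINT t | PiM UNIV (\<lambda>_. lborel).
      (\<Prod>j\<in>UNIV. indicator {0..2*pi} (t j) * (\<i> / x (t j) ^ l j)) *
      (\<Prod>j\<in>UNIV. exp (c j * x (t j))) *
      (\<Prod>k\<in>UNIV. F k (\<Sum>j\<in>UNIV. \<gamma> $ j $ k * x (t j)))) =
    (2 * of_real pi * \<i>) ^ CARD('d) *
      (\<Sum>(m, \<nu>) \<in> {(m :: 'd \<Rightarrow> nat, \<nu> :: 'd \<Rightarrow> 'r \<Rightarrow> nat). \<forall>j. m j + (\<Sum>k\<in>UNIV. \<nu> j k) = l j}.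
         (\<Prod>k\<in>UNIV. a k (\<Sum>j\<in>UNIV. \<nu> j k)) *
         (\<Prod>j\<in>UNIV. c j ^ m j / fact (m j)) *
         (\<Prod>j\<in>UNIV. \<Prod>k\<in>UNIV. (\<gamma> $ j $ k) ^ \<nu> j k / fact (\<nu> j k)))" (is "?I = ?R")
proof -
  interpret product_sigma_finite "\<lambda>_::'d. lborel::real measure" by standard
  let ?M = "PiM (UNIV::'d set) (\<lambda>_. lborel :: real measure)"
  have nx: "norm (x t) = \<epsilon>" for t using e by (simp add: x_def norm_mult)
  have [measurable]: "x \<in> borel_measurable borel" unfolding x_def by measurable
  define W where "W t = (\<Prod>j\<in>UNIV. indicator {0..2*pi} (t j) * (\<i> / x (t j) ^ l j))" for t :: "'d \<Rightarrow> real"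
  define E where "E N t = (\<Prod>j\<in>UNIV. \<Sum>m\<le>N. (c j * x (t j)) ^ m / fact m)" for N and t :: "'d \<Rightarrow> real"
  define P where "P N t = (\<Prod>k\<in>UNIV. \<Sum>n\<le>N. a k n / fact n * (\<Sum>j\<in>UNIV. \<gamma> $ j $ k * x (t j)) ^ n)"
    for N and t :: "'d \<Rightarrow> real"
  have [measurable]: "W \<in> borel_measurable ?M" "E N \<in> borel_measurable ?M" "P N \<in> borel_measurable ?M" for N
    unfolding W_def E_def P_def by measurable
  have ny: "norm (\<Sum>j\<in>UNIV. \<gamma> $ j $ k * x (t j)) \<le> G k" for k and t :: "'d \<Rightarrow> real"
  proof -
    have "norm (\<Sum>j\<in>UNIV. \<gamma> $ j $ k * x (t j)) \<le> (\<Sum>j\<in>UNIV. norm (\<gamma> $ j $ k) * \<epsilon>)"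
      by (intro sum_norm_le) (simp add: norm_mult nx)
    also have "\<dots> \<le> G k" using G[of k] by (simp add: sum_distrib_right)
    finally show ?thesis .
  qed
  have Elim: "(\<lambda>N. E N t) \<longlonglongrightarrow> (\<Prod>j\<in>UNIV. exp (c j * x (t j)))" for t
    unfolding E_def
  proof (intro tendsto_prod)
    fix j
    show "(\<lambda>N. \<Sum>m\<le>N. (c j * x (t j)) ^ m / fact m) \<longlonglongrightarrow> exp (c j * x (t j))"
      using exp_converges[of "c j * x (t j)"]
      by (simp add: sums_def_le scaleR_conv_of_real divide_inverse mult.commute)
  qed
  have Plim: "(\<lambda>N. P N t) \<longlonglongrightarrow> (\<Prod>k\<in>UNIV. F k (\<Sum>j\<in>UNIV. \<gamma> $ j $ k * x (t j)))" for t
    unfolding P_def using sums[OF ny] by (intro tendsto_prod) (auto simp: sums_def_le)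
  have Eb: "norm (E N t) \<le> (\<Prod>j\<in>UNIV. exp (norm (c j) * \<epsilon>))" for N t
    unfolding E_def prod_norm[symmetric]
  proof (intro prod_mono conjI norm_ge_zero)
    fix j
    have "norm (\<Sum>m\<le>N. (c j * x (t j)) ^ m / fact m) \<le> (\<Sum>m\<le>N. (norm (c j) * \<epsilon>) ^ m /\<^sub>R fact m)"
      by (intro sum_norm_le) (simp add: norm_divide norm_power norm_mult nx divide_inverse norm_inverse mult.commute)
    also have "\<dots> \<le> (\<Sum>m. (norm (c j) * \<epsilon>) ^ m /\<^sub>R fact m)"
      using e by (intro sum_le_suminf summable_exp_generic) auto
    finally show "norm (\<Sum>m\<le>N. (c j * x (t j)) ^ m / fact m) \<le> exp (norm (c j) * \<epsilon>)"
      by (simp add: exp_def)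
  qed
  have Pb: "norm (P N t) \<le> (\<Prod>k\<in>UNIV. \<Sum>n. norm (a k n / fact n) * G k ^ n)" for N t
    unfolding P_def prod_norm[symmetric]
  proof (intro prod_mono conjI norm_ge_zero)
    fix k
    have G0: "G k \<ge> 0" using ny[of k t] norm_ge_zero order_trans by blast
    have "norm (\<Sum>n\<le>N. a k n / fact n * (\<Sum>j\<in>UNIV. \<gamma> $ j $ k * x (t j)) ^ n) \<le>
        (\<Sum>n\<le>N. norm (a k n / fact n) * G k ^ n)"
      by (rule sum_norm_le)
         (unfold norm_mult norm_power, intro mult_left_mono power_mono ny norm_ge_zero)
    also have "\<dots> \<le> (\<Sum>n. norm (a k n / fact n) * G k ^ n)"
      using G0 by (intro sum_le_suminf summable) auto
    finally show "norm (\<Sum>n\<le>N. a k n / fact n * (\<Sum>j\<in>UNIV. \<gamma> $ j $ k * x (t j)) ^ n) \<le>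
        (\<Sum>n. norm (a k n / fact n) * G k ^ n)" .
  qed
  \<comment> \<open>The full series of absolute values bound all truncations, independently of
    \<open>N\<close> and \<open>t\<close>; integrability comes from \<open>W\<close>, which vanishes
    off the cube.\<close>
  define K where "K = (\<Prod>j\<in>UNIV. exp (norm (c j) * \<epsilon>)) * (\<Prod>k\<in>UNIV. \<Sum>n. norm (a k n / fact n) * G k ^ n)"
  have "integrable ?M W"
    unfolding W_def
  proof (intro product_integrable_prod)
    show "integrable lborel (\<lambda>t. indicator {0..2*pi} t * (\<i> / x t ^ l j))" for j
      using circle_integral_monomial(1)[OF e, of "l j" 0] by (simp add: x_def)
  qed simp
  then have Wi: "integrable ?M (\<lambda>t. norm (W t) * K)" by (intro integrable_mult_left integrable_norm)
  have "(\<lambda>N. LINT t | ?M. W t * E N t * P N t) \<longlonglongrightarrow>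
      (LINT t | ?M. W t * (\<Prod>j\<in>UNIV. exp (c j * x (t j))) * (\<Prod>k\<in>UNIV. F k (\<Sum>j\<in>UNIV. \<gamma> $ j $ k * x (t j))))"
  proof (rule integral_dominated_convergence[OF _ _ Wi])
    have lim: "(\<lambda>N. W t * E N t * P N t) \<longlonglongrightarrow>
        W t * (\<Prod>j\<in>UNIV. exp (c j * x (t j))) * (\<Prod>k\<in>UNIV. F k (\<Sum>j\<in>UNIV. \<gamma> $ j $ k * x (t j)))" for t
      by (intro tendsto_mult tendsto_const Elim Plim)
    then show "AE t in ?M. (\<lambda>N. W t * E N t * P N t) \<longlonglongrightarrow>
        W t * (\<Prod>j\<in>UNIV. exp (c j * x (t j))) * (\<Prod>k\<in>UNIV. F k (\<Sum>j\<in>UNIV. \<gamma> $ j $ k * x (t j)))"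
      by (intro AE_I2)
    \<comment> \<open>Nothing is assumed about measurability of \<open>F\<close>; the limit inherits
      it from the truncations.\<close>
    show "(\<lambda>t. W t * (\<Prod>j\<in>UNIV. exp (c j * x (t j))) * (\<Prod>k\<in>UNIV. F k (\<Sum>j\<in>UNIV. \<gamma> $ j $ k * x (t j))))
        \<in> borel_measurable ?M"
      by (rule borel_measurable_LIMSEQ_metric[OF _ lim]) measurable
    show "AE t in ?M. norm (W t * E N t * P N t) \<le> norm (W t) * K" for N
      unfolding K_def norm_mult mult.assoc
      by (intro AE_I2 mult_left_mono mult_mono Eb Pb prod_nonneg) auto
  qed measurable
  moreover have "(\<lambda>N. LINT t | ?M. W t * E N t * P N t) \<longlonglongrightarrow> ?R"
  proof (rule tendsto_eventually)
    show "\<forall>\<^sub>F N in sequentially. (LINT t | ?M. W t * E N t * P N t) = ?R"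
      using eventually_ge_at_top[of "\<Sum>j\<in>UNIV. l j"]
    proof eventually_elim
      case (elim N)
      show ?case unfolding W_def E_def P_def x_def by (rule torus_integral_truncated[OF e elim])
    qed
  qed
  ultimately show ?thesis unfolding W_def by (rule LIMSEQ_unique)
qed

theorem theorem2p7:
  fixes \<xi> :: "complex^'r" and \<gamma> :: "complex^'r^'d" and \<beta> :: "complex^'d"
    and l :: "'d \<Rightarrow> nat"
  assumes "\<And>k. norm (\<xi> $ k) \<le> 1"
    and "\<And>j k. Re (\<gamma> $ j $ k) \<ge> 0"
    and "\<And>j. Re (\<beta> $ j) > 0"
    and "\<And>j. \<exists>k. Re (\<gamma> $ j $ k) > 0"
    and "\<forall>\<^sub>F \<epsilon> in at_right 0. hankel_avoids_poles \<epsilon> \<xi> \<gamma>"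
  shows "\<forall>\<^sub>F \<epsilon> in at_right 0.
    zeta_des \<epsilon> \<xi> \<gamma> \<beta> (\<chi> j. - of_nat (l j)) =
      (\<Prod>j\<in>UNIV. (-1) ^ l j * fact (l j)) *
      (\<Sum>(m, \<nu>) \<in> {(m :: 'd \<Rightarrow> nat, \<nu> :: 'd \<Rightarrow> 'r \<Rightarrow> nat).
                     \<forall>j. m j + (\<Sum>k\<in>UNIV. \<nu> j k) = l j}.
         (\<Prod>k\<in>UNIV. des_F_coeff (des_delta (\<xi> $ k)) (\<xi> $ k) (\<Sum>j\<in>UNIV. \<nu> j k)) *
         (\<Prod>j\<in>UNIV. ((\<Sum>k\<in>UNIV. \<gamma> $ j $ k) - \<beta> $ j) ^ m j / fact (m j)) *
         (\<Prod>j\<in>UNIV. \<Prod>k\<in>UNIV. (\<gamma> $ j $ k) ^ \<nu> j k / fact (\<nu> j k)))"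
proof -
  have pos: "\<forall>\<^sub>F \<epsilon> in at_right 0. \<epsilon> > (0::real)" by (simp add: eventually_at_right_less)
  have "\<forall>\<^sub>F \<epsilon> in at_right 0. \<epsilon> > 0 \<and> hankel_avoids_poles \<epsilon> \<xi> \<gamma>"
    using pos assms(5) by eventually_elim simp
  \<comment> \<open>The conclusion about \<gamma> does not mention the contour, so a single good
    radius suffices.\<close>
  then obtain \<epsilon>0 where "\<epsilon>0 > 0" "hankel_avoids_poles \<epsilon>0 \<xi> \<gamma>"
    using eventually_happens'[OF trivial_limit_at_right_real] by blast
  then have gam': "\<gamma> $ j $ k = 0 \<or> Re (\<gamma> $ j $ k) > 0" if "norm (\<xi> $ k) = 1" for j k
    using hankel_avoids_poles_imp_Re_pos that assms(2) by blast
  have bdd: "\<forall>\<^sub>F \<epsilon> in at_right 0. des_F_contour_bounded \<epsilon> \<xi> \<gamma>"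
    by (rule eventually_des_F_contour_bounded[OF assms(1,2) gam'])
  have "\<forall>k. \<exists>\<rho>>0. \<forall>y. norm y < \<rho> \<longrightarrow> exp y = \<xi> $ k \<longrightarrow> y = 0"
    using exp_eq_isolated_at_0 by metis
  from choice[OF this] obtain \<rho> where
    \<rho>: "\<And>k. \<rho> k > 0" "\<And>k y. norm y < \<rho> k \<Longrightarrow> exp y = \<xi> $ k \<Longrightarrow> y = 0" by blast
  \<comment> \<open>A third leaves room for \<open>2 * G k < \<rho> k\<close>: convergence at the
    larger radius gives absolute convergence at \<open>G k\<close>.\<close>
  define G where "G k = \<rho> k / 3" for k
  have small: "\<forall>\<^sub>F \<epsilon> in at_right 0. \<forall>k. (\<Sum>j\<in>UNIV. norm (\<gamma> $ j $ k)) * \<epsilon> < G k"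
  proof (rule eventually_all_finite)
    fix k
    have "((\<lambda>\<epsilon>. (\<Sum>j\<in>UNIV. norm (\<gamma> $ j $ k)) * \<epsilon>) \<longlongrightarrow> (\<Sum>j\<in>UNIV. norm (\<gamma> $ j $ k)) * 0) (at_right 0)"
      by (intro tendsto_intros)
    then show "\<forall>\<^sub>F \<epsilon> in at_right 0. (\<Sum>j\<in>UNIV. norm (\<gamma> $ j $ k)) * \<epsilon> < G k"
      using \<rho>(1)[of k] by (intro order_tendstoD(2)) (auto simp: G_def)
  qed
  show ?thesis
    using pos assms(5) bdd small
  proof eventually_elim
    case (elim \<epsilon>)
    have G: "(\<Sum>j\<in>UNIV. norm (\<gamma> $ j $ k)) * \<epsilon> \<le> G k" for k using elim(4) by (simp add: less_imp_le)
    have ser: "(\<lambda>n. des_F_coeff (des_delta (\<xi> $ k)) (\<xi> $ k) n / fact n * y ^ n) sums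
        des_F (des_delta (\<xi> $ k)) (\<xi> $ k) y" if "norm y < \<rho> k" for k y
      using des_F_sums[OF \<rho>(2) that] .
    have S: "summable (\<lambda>n. norm (des_F_coeff (des_delta (\<xi> $ k)) (\<xi> $ k) n / fact n) * G k ^ n)" for k
    proof -
      have "summable (\<lambda>n. des_F_coeff (des_delta (\<xi> $ k)) (\<xi> $ k) n / fact n * (of_real (2 * G k)) ^ n)"
        using ser[of "of_real (2 * G k)" k] \<rho>(1)[of k] by (intro sums_summable) (auto simp: G_def)
      then have "summable (\<lambda>n. norm (des_F_coeff (des_delta (\<xi> $ k)) (\<xi> $ k) n / fact n * of_real (G k) ^ n))"
        by (rule powser_insidea) (use \<rho>(1)[of k] in \<open>auto simp: G_def\<close>)
      then show ?thesis using \<rho>(1)[of k] by (simp add: norm_mult norm_power norm_divide G_def)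
    qed
    \<comment> \<open>This power stands in the denominator of the limiting prefactor and in front of
      the torus integral, and it cancels.\<close>
    have "(2 * of_real pi * \<i>) ^ CARD('d) \<noteq> (0::complex)" by simp
    moreover have "norm y < \<rho> k" if "norm y \<le> G k" for y :: complex and k
      using that \<rho>(1)[of k] by (simp add: G_def)
    ultimately show ?case
      unfolding zeta_des_at_neg_int[OF elim(1) assms(3) elim(2,3)]
        hankel_integral_neg_int[OF elim(1) assms(3) elim(2,3)]
      by (subst torus_integral[OF elim(1) G ser S]) simp_all
  qed
qed

end
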